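(* For integers $d\ge1$ and $a$ put $H(x;d,a)=\sum_{p^r\le x,\ r\ge1,\ p\equiv a\ (\mathrm{mod}\ d)}\frac{\log p}{p^r}$, and define $$C_+(d,a)=\sup_{x\ge1}\Big(H(x;d,a)-\tfrac12\log x\Big),\qquad C_-(d,a)=\inf_{x\ge1}\Big(H(x;d,a)-\tfrac12\log x\Big).$$ Then: (a) $C_-(4,1)>-1.202$ and $C_+(4,1)=0$; (b) $C_-(4,3)=\frac{\log 3}{3}-\frac{\log 7}{2}=-0.606750\ldots$ and $C_+(4,3)=0$; (c) $C_-(3,1)>-1.4$ and $C_+(3,1)=0$; (d) $C_-(3,2)=-\frac{\log 2}{2}=-0.34657\ldots$ and $C_+(3,2)<0.2764$.
   Context: Here $p$ runs over primes and $r$ over positive integers. (In the paper's notation, $H(x;d,a)=\sum_{n\le x}\Lambda_{g_{d,a}}(n)/n$, where $\Lambda_{g_{d,a}}(n)=\log p$ if $n=p^r$ with $r\ge1$ and $p\equiv a\pmod d$, and $0$ otherwise, and $C_\pm(d,a)$ are the quantities $C_\pm(g_{d,a})$ with $\tau=1/2$.) *)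

theory Defs
  imports "HOL-Analysis.Analysis" "HOL-Number_Theory.Number_Theory"
begin

definition Lambda_g :: "int \<Rightarrow> int \<Rightarrow> nat \<Rightarrow> real" where
  "Lambda_g d a n =
     (if \<exists>p r. prime p \<and> r \<ge> 1 \<and> n = p ^ r \<and> [int p = a] (mod d)
      then ln (real (THE p. prime p \<and> (\<exists>r\<ge>1. n = p ^ r))) else 0)"

definition H :: "real \<Rightarrow> int \<Rightarrow> int \<Rightarrow> real" where
  "H x d a = (\<Sum>n\<in>{1..nat \<lfloor>x\<rfloor>}. Lambda_g d a n / real n)"

definition C_plus :: "int \<Rightarrow> int \<Rightarrow> real" where
  "C_plus d a = (SUP x\<in>{1..}. H x d a - ln x / 2)"

definition C_minus :: "int \<Rightarrow> int \<Rightarrow> real" where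
  "C_minus d a = (INF x\<in>{1..}. H x d a - ln x / 2)"

end

theory Submission
  imports Defs "HOL-Real_Asymp.Real_Asymp"
begin

text \<open>
  Up to terms supported on powers of 2 and 3 and on squares, the sums \<open>H(x; 4, a)\<close> and \<open>H(x; 3, a)\<close>
  are half of \<open>M \<plusminus> X\<close>, where \<open>M = \<Sum>\<Lambda>(n)/n\<close> and \<open>X = \<Sum>\<chi>(n)\<Lambda>(n)/n\<close> for a character \<open>\<chi>\<close> modulo 12 or 6.

  For a kernel \<open>A(t) = \<Sum>\<^sub>m\<^sub>\<le>\<^sub>t \<alpha>(m)/m\<close> that converges quickly to \<open>L\<close>, the sum
  \<open>\<Sum>\<^sub>n \<Lambda>(n)/n A(x/n)\<close> is elementary: Chebyshev's kernel of period 30 handles \<open>M\<close>, and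
  \<open>\<alpha> = \<chi>\<close> handles \<open>X\<close>. Replacing \<open>A(x/n)\<close> by \<open>L\<close> for \<open>n \<le> x/(K+1)\<close> costs at most
  \<open>O(\<psi>(x/(K+1))/x)\<close>, so \<open>M(x) - ln x\<close> and \<open>X(x)\<close> satisfy contracting recurrences in which only their values
  at \<open>x/m\<close>, \<open>5 \<le> m \<le> 11\<close>, occur. Together with \<open>\<psi>(x) \<le> 1.15 x\<close> this keeps them within
  explicit distances of their limits for all \<open>x \<ge> 1000\<close>, and
  the distances are small enough for all inequalities of the theorem. The range below 1000, which also provides the initial
  values, is settled by integer interval arithmetic.
\<close>

section \<open>Hyperbola sums of the von Mangoldt function\<close>

text \<open>Beyond 1000 only boundedness is proved, not convergence. A recurrence with error e whose
  weights have absolute sum rho keeps a deviation below e / (1 - rho) once it holds initially; rho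
  is about 0.08 for \<open>M\<close>, 0.36 for the character modulo 12 and 0.10 for the one modulo
  6. The error e comes from the divisors d up to x/(K+1), so a larger K shrinks e but moves more
  terms into rho.

  The constant kernel cannot serve for \<open>M\<close>, because the partial sums of 1/m diverge.
  Chebyshev's combination of floors removes the divergence and the leading logarithmic terms at
  once, since 1 - 1/2 - 1/3 - 1/5 + 1/30 = 0.

  The exact values do not strain the analytic part: all of them are decided by x up to 7 (the
  suprema at x = 1, the infima as x tends to 7 and to 2 from the left). For large x there is a fixed
  margin, narrowest in the lower bound for the class 2 mod 3, and this margin dictates how small the
  radii have to be.\<close>

lemma sum_hyperbola:
  fixes F b :: "nat \<Rightarrow> 'a::comm_semiring_0"
  shows "(\<Sum>d\<in>{1..N}. F d * (\<Sum>m\<in>{1..N div d}. b m)) = (\<Sum>k\<in>{1..N}. \<Sum>d | d dvd k. F d * b (k div d))"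
proof -
  have fin: "finite {d. d dvd k}" if "k \<in> {1..N}" for k
    using that by (intro finite_divisors_nat) auto
  have "(\<Sum>d\<in>{1..N}. F d * (\<Sum>m\<in>{1..N div d}. b m)) = (\<Sum>(d,m)\<in>Sigma {1..N} (\<lambda>d. {1..N div d}). F d * b m)"
    by (simp add: sum_distrib_left sum.Sigma)
  also have "\<dots> = (\<Sum>(k,d)\<in>Sigma {1..N} (\<lambda>k. {d. d dvd k}). F d * b (k div d))"
  proof (rule sum.reindex_bij_witness[of _ "\<lambda>(k,d). (d, k div d)" "\<lambda>(d,m). (d*m, d)"], goal_cases)
    case (2 x)
    then obtain d m where x: "x = (d, m)" "1 \<le> d" "1 \<le> m" "m \<le> N div d" by auto
    then have "d * m \<le> N" by (simp add: less_eq_div_iff_mult_less_eq mult.commute)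
    moreover have "d * 1 \<le> d * m" using x by (intro mult_le_mono2) auto
    ultimately have "d \<le> N" "d * m \<le> N" by linarith+
    then show ?case using x by auto
  next
    case (4 x)
    then obtain k d where x: "x = (k,d)" "1 \<le> k" "k \<le> N" "d dvd k" by auto
    then obtain m where m: "k = d * m" by (auto simp: dvd_def)
    have "m \<le> N div d"
      using x m by (subst less_eq_div_iff_mult_less_eq) (auto simp: mult.commute)
    moreover have "d \<le> N" using dvd_imp_le[OF x(4)] x by linarith
    ultimately show ?case using x m by auto
  qed auto
  also have "\<dots> = (\<Sum>k\<in>{1..N}. \<Sum>d | d dvd k. F d * b (k div d))"
    using fin by (subst sum.Sigma) auto
  finally show ?thesis .
qed

text \<open>Complete multiplicativity pulls \<open>f k\<close> out of the divisor sum, leaving the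
  identity that \<open>mangoldt\<close> summed over the divisors of k is ln k.\<close>

lemma sum_mangoldt_mult:
  fixes f :: "nat \<Rightarrow> real"
  assumes mult: "\<And>m n. f (m * n) = f m * f n"
  shows "(\<Sum>d\<in>{1..N}. mangoldt d * f d * (\<Sum>m\<in>{1..N div d}. f m)) = (\<Sum>k\<in>{1..N}. f k * ln (real k))"
proof -
  have "(\<Sum>d | d dvd k. mangoldt d * f d * f (k div d)) = f k * ln (real k)" if "k \<in> {1..N}" for k
  proof -
    have "(\<Sum>d | d dvd k. mangoldt d * f d * f (k div d)) = (\<Sum>d | d dvd k. f k * mangoldt d)"
      by (rule sum.cong) (auto simp: mult.assoc mult simp flip: mult)
    also have "\<dots> = f k * ln (real k)"
      using that mangoldt_sum[of k, where ?'a = real] by (simp flip: sum_distrib_left)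
    finally show ?thesis .
  qed
  then show ?thesis
    using sum_hyperbola[of "\<lambda>d. mangoldt d * f d" f N] by simp
qed

text \<open>Nested floors commute, and the terms with d beyond \<open>N div j\<close> vanish because
  \<open>S 0 = 0\<close>.\<close>

lemma sum_div_restrict:
  fixes F S :: "nat \<Rightarrow> real"
  assumes "S 0 = 0" "j > 0"
  shows "(\<Sum>d\<in>{1..N}. F d * S (N div d div j)) = (\<Sum>d\<in>{1..N div j}. F d * S (N div j div d))"
proof -
  have eq: "N div d div j = N div j div d" for d
    by (metis div_mult2_eq mult.commute)
  have "(\<Sum>d\<in>{1..N div j}. F d * S (N div j div d)) = (\<Sum>d\<in>{1..N}. F d * S (N div j div d))"
  proof (rule sum.mono_neutral_left)
    show "{1..N div j} \<subseteq> {1..N}"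
      by (simp add: atLeastatMost_subset_iff)
  qed (use assms in auto)
  then show ?thesis by (simp add: eq)
qed

lemma sum_div_indicator:
  fixes F :: "nat \<Rightarrow> real"
  assumes "m > 0"
  shows "(\<Sum>d\<in>{1..N}. if m \<le> N div d then F d else 0) = (\<Sum>d\<in>{1..N div m}. F d)"
proof -
  have "(\<Sum>d\<in>{1..N}. if m \<le> N div d then F d else 0) = (\<Sum>d\<in>{d\<in>{1..N}. m \<le> N div d}. F d)"
    by (rule sum.inter_filter[symmetric]) simp
  also have "{d\<in>{1..N}. m \<le> N div d} = {1..N div m}"
  proof -
    have "m \<le> N div d \<longleftrightarrow> d \<le> N div m" if "d > 0" for d
      using that assms by (simp add: less_eq_div_iff_mult_less_eq mult.commute)
    moreover have "d \<le> N div m \<Longrightarrow> d \<le> N" for d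
      using div_le_dividend le_trans by blast
    ultimately show ?thesis by auto
  qed
  finally show ?thesis .
qed

definition psi :: "nat \<Rightarrow> real" where
  "psi n = (\<Sum>d\<in>{1..n}. mangoldt d)"

definition msum :: "(nat \<Rightarrow> real) \<Rightarrow> nat \<Rightarrow> real" where
  "msum f n = (\<Sum>d\<in>{1..n}. mangoldt d * f d / real d)"

text \<open>
  The divisors \<open>d\<close> with \<open>N div d \<le> K\<close> are kept exactly, for the others \<open>A\<close> is replaced by its limit \<open>L\<close>.
  When \<open>a 1 = 1\<close> dominates the remaining weights, this turns bounds for \<open>msum\<close> at the arguments
  \<open>N div m\<close>, \<open>1 < m\<close>, into a bound at \<open>N\<close>.
\<close>

lemma msum_hyperbola_approx:
  fixes a f :: "nat \<Rightarrow> real"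
  defines "A \<equiv> \<lambda>t. \<Sum>m\<in>{1..t}. a m"
  assumes f: "\<And>d. \<bar>f d\<bar> \<le> 1"
    and A: "\<And>t. t > K \<Longrightarrow> \<bar>A t - L\<bar> * (real t + 1) \<le> c" and N: "N > 0"
  shows "\<bar>(\<Sum>d\<in>{1..N}. mangoldt d * f d / real d * A (N div d))
          - (\<Sum>m\<in>{1..K}. a m * msum f (N div m)) - (L - A K) * msum f (N div Suc K)\<bar>
         \<le> c * psi (N div Suc K) / real N"
proof -
  define F where "F d = mangoldt d * f d / real d" for d
  have split: "A t = (\<Sum>m\<in>{1..K}. if m \<le> t then a m else 0) +
                 (if Suc K \<le> t then L - A K else 0) + (if Suc K \<le> t then A t - L else 0)" for t
  proof (cases "Suc K \<le> t")
    case True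
    then show ?thesis by (simp add: A_def)
  next
    case False
    then have "(\<Sum>m\<in>{1..K}. if m \<le> t then a m else 0) = (\<Sum>m\<in>{m\<in>{1..K}. m \<le> t}. a m)"
      by (intro sum.inter_filter[symmetric]) simp
    also have "{m\<in>{1..K}. m \<le> t} = {1..t}" using False by auto
    finally show ?thesis using False by (simp add: A_def)
  qed
  have "(\<Sum>d\<in>{1..N}. F d * A (N div d)) =
     (\<Sum>d\<in>{1..N}. \<Sum>m\<in>{1..K}. if m \<le> N div d then F d * a m else 0)
   + (\<Sum>d\<in>{1..N}. if Suc K \<le> N div d then F d * (L - A K) else 0)
   + (\<Sum>d\<in>{1..N}. if Suc K \<le> N div d then F d * (A (N div d) - L) else 0)"
    unfolding sum.distrib[symmetric]
    by (rule sum.cong[OF refl], subst split)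
       (auto simp: algebra_simps sum_distrib_left intro!: sum.cong)
  also have "(\<Sum>d\<in>{1..N}. \<Sum>m\<in>{1..K}. if m \<le> N div d then F d * a m else 0)
     = (\<Sum>m\<in>{1..K}. \<Sum>d\<in>{1..N}. if m \<le> N div d then F d * a m else 0)"
    by (rule sum.swap)
  also have "\<dots> = (\<Sum>m\<in>{1..K}. a m * msum f (N div m))"
    by (rule sum.cong[OF refl], subst sum_div_indicator)
       (auto simp: msum_def F_def sum_distrib_left mult_ac)
  also have "(\<Sum>d\<in>{1..N}. if Suc K \<le> N div d then F d * (L - A K) else 0) = (L - A K) * msum f (N div Suc K)"
    by (subst sum_div_indicator) (auto simp: msum_def F_def sum_distrib_left mult_ac)
  also have "(\<Sum>d\<in>{1..N}. if Suc K \<le> N div d then F d * (A (N div d) - L) else 0)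
     = (\<Sum>d\<in>{1..N div Suc K}. F d * (A (N div d) - L))"
    by (subst sum_div_indicator) auto
  finally have "(\<Sum>d\<in>{1..N}. F d * A (N div d)) - (\<Sum>m\<in>{1..K}. a m * msum f (N div m)) - (L - A K) * msum f (N div Suc K)
      = (\<Sum>d\<in>{1..N div Suc K}. F d * (A (N div d) - L))" by simp
  moreover have "\<bar>\<Sum>d\<in>{1..N div Suc K}. F d * (A (N div d) - L)\<bar> \<le> (\<Sum>d\<in>{1..N div Suc K}. c * mangoldt d / real N)"
  proof (rule order.trans[OF sum_abs], rule sum_mono)
    fix d assume d: "d \<in> {1..N div Suc K}"
    then have "Suc K \<le> N div d"
      by (simp add: less_eq_div_iff_mult_less_eq mult.commute del: mult_Suc mult_Suc_right)
    then have A': "\<bar>A (N div d) - L\<bar> * (real (N div d) + 1) \<le> c" by (intro A) auto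
    \<comment> \<open>Decay of order 1/(t+1) at t = \<open>N div d\<close> is exactly what cancels
      the factor 1/d: what remains is \<open>mangoldt d\<close> with a weight c/N independent of d,
      hence \<open>psi\<close>.\<close>
    have "N < d + d * (N div d)" using d by (intro dividend_less_times_div) auto
    then have N': "real N \<le> real d * (real (N div d) + 1)"
      by (simp add: algebra_simps flip: of_nat_mult of_nat_add)
    have "\<bar>A (N div d) - L\<bar> * real N \<le> \<bar>A (N div d) - L\<bar> * (real d * (real (N div d) + 1))"
      by (rule mult_left_mono[OF N']) auto
    also have "\<dots> \<le> real d * c"
      using mult_left_mono[OF A', of "real d"] by (simp add: mult_ac)
    finally have 1: "\<bar>A (N div d) - L\<bar> / real d \<le> c / real N"
      using d N by (simp add: field_simps)
    have "\<bar>F d * (A (N div d) - L)\<bar> = mangoldt d * \<bar>f d\<bar> * (\<bar>A (N div d) - L\<bar> / real d)"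
      by (simp add: F_def abs_mult mangoldt_nonneg)
    also have "\<dots> \<le> mangoldt d * 1 * (\<bar>A (N div d) - L\<bar> / real d)"
      by (intro mult_right_mono mult_left_mono f mangoldt_nonneg) auto
    also have "\<dots> \<le> mangoldt d * 1 * (c / real N)"
      by (intro mult_left_mono 1) (auto simp: mangoldt_nonneg)
    finally show "\<bar>F d * (A (N div d) - L)\<bar> \<le> c * mangoldt d / real N" by (simp add: mult_ac)
  qed
  moreover have "(\<Sum>d\<in>{1..N div Suc K}. c * mangoldt d / real N) = c * psi (N div Suc K) / real N"
    by (simp add: psi_def sum_distrib_left sum_divide_distrib)
  ultimately show ?thesis by (simp add: F_def)
qed

text \<open>
  Summation by parts, twice: the corrected partial sum \<open>A t - (G t - g) / (t + 1) - G2 t / ((t + 1) (t + 2))\<close>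
  has increments \<open>2 G2 (t + 1) / ((t + 1) (t + 2) (t + 3))\<close>, so with the bounds of \<open>G2\<close> it yields
  one increasing and one decreasing sequence with the same limit.
\<close>

lemma twice_summed_limit:
  fixes a :: "nat \<Rightarrow> real" and g b0 b1 :: real
  defines "A \<equiv> \<lambda>t. \<Sum>m\<in>{1..t}. a m / real m"
  defines "G \<equiv> \<lambda>t. \<Sum>m\<in>{1..t}. a m"
  defines "G2 \<equiv> \<lambda>t. \<Sum>m\<in>{1..t}. G m - g"
  assumes b: "\<And>t. b0 \<le> G2 t" "\<And>t. G2 t \<le> b1"
  obtains L where "A \<longlonglongrightarrow> L"
    "\<And>t. A t - L \<ge> (G t - g) / (real t + 1) + (G2 t - b1) / ((real t + 1) * (real t + 2))"
    "\<And>t. A t - L \<le> (G t - g) / (real t + 1) + (G2 t - b0) / ((real t + 1) * (real t + 2))"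
proof -
  define V where "V t = A t - (G t - g) / (real t + 1) - G2 t / ((real t + 1) * (real t + 2))" for t
  define e where "e t = 1 / ((real t + 1) * (real t + 2))" for t :: nat
  have V_Suc: "V (Suc t) - V t = G2 (Suc t) * (e t - e (Suc t))" for t
  proof -
    define x where "x = real t"
    have x: "x \<ge> 0" by (simp add: x_def)
    have G: "G (Suc t) = G t + a (Suc t)" by (simp add: G_def)
    have G2: "G2 (Suc t) = G2 t + G t + a (Suc t) - g" by (simp add: G2_def G)
    have A: "A (Suc t) = A t + a (Suc t) / (x + 1)" by (simp add: A_def x_def add.commute)
    show ?thesis unfolding V_def e_def G G2 A of_nat_Suc x_def[symmetric]
      using x by (simp add: divide_simps) (simp add: algebra_simps)
  qed
  have e_dec: "e (Suc t) \<le> e t" for t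
    unfolding e_def by (intro divide_left_mono mult_mono mult_pos_pos) auto
  have lo: "incseq (\<lambda>t. V t + b0 * e t)"
  proof (rule incseq_SucI)
    fix t
    have "b0 * (e t - e (Suc t)) \<le> V (Suc t) - V t"
      unfolding V_Suc using b e_dec by (intro mult_right_mono) auto
    then show "V t + b0 * e t \<le> V (Suc t) + b0 * e (Suc t)" by (simp add: algebra_simps)
  qed
  have hi: "decseq (\<lambda>t. V t + b1 * e t)"
  proof (rule decseq_SucI)
    fix t
    have "V (Suc t) - V t \<le> b1 * (e t - e (Suc t))"
      unfolding V_Suc using b e_dec by (intro mult_right_mono) auto
    then show "V (Suc t) + b1 * e (Suc t) \<le> V t + b1 * e t" by (simp add: algebra_simps)
  qed
  have b01: "b0 \<le> b1" using b[of 0] by linarith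
  have bd: "\<forall>t. V t + b0 * e t \<le> V 0 + b1 * e 0"
  proof
    fix t
    have "b0 * e t \<le> b1 * e t" using b01 by (intro mult_right_mono) (auto simp: e_def)
    with decseqD[OF hi, of 0 t] show "V t + b0 * e t \<le> V 0 + b1 * e 0" by simp
  qed
  from incseq_convergent[OF lo bd] obtain L where L: "(\<lambda>t. V t + b0 * e t) \<longlonglongrightarrow> L"
    and L_lo: "\<And>t. V t + b0 * e t \<le> L" by blast
  have e0: "e \<longlonglongrightarrow> 0" unfolding e_def by real_asymp
  from tendsto_diff[OF L tendsto_mult_right[OF e0, of b0]] have V: "V \<longlonglongrightarrow> L"
    by (simp add: mult.commute)
  have "(\<lambda>t. V t + b1 * e t) \<longlonglongrightarrow> L"
    using tendsto_add[OF V tendsto_mult_right[OF e0, of b1]] by (simp add: mult.commute)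
  from decseq_ge[OF hi this] have L_hi: "L \<le> V t + b1 * e t" for t .
  \<comment> \<open>\<open>G t - g\<close> is a difference of two consecutive values of the bounded
    sequence \<open>G2\<close>.\<close>
  have Gb: "\<bar>G t - g\<bar> \<le> b1 - b0 + \<bar>g\<bar>" for t
  proof (cases t)
    case 0
    then show ?thesis using b01 by (simp add: G_def)
  next
    case (Suc s)
    have "G2 t = G2 s + (G t - g)" by (simp add: G2_def Suc)
    with b[of t] b[of s] show ?thesis by linarith
  qed
  have r: "(\<lambda>t. 1 / (real t + 1)) \<longlonglongrightarrow> 0" by real_asymp
  have G0: "(\<lambda>t. (G t - g) / (real t + 1)) \<longlonglongrightarrow> 0"
  proof (rule Lim_null_comparison[OF _ tendsto_mult_right_zero[OF r]])
    show "\<forall>\<^sub>F t in sequentially. norm ((G t - g) / (real t + 1)) \<le> (b1 - b0 + \<bar>g\<bar>) * (1 / (real t + 1))"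
      using Gb by (intro always_eventually allI) (simp add: divide_right_mono)
  qed
  have G20: "(\<lambda>t. G2 t / ((real t + 1) * (real t + 2))) \<longlonglongrightarrow> 0"
  proof (rule Lim_null_comparison[OF _ tendsto_mult_right_zero[OF e0, of "\<bar>b0\<bar> + \<bar>b1\<bar>"]])
    have "\<bar>G2 t\<bar> \<le> \<bar>b0\<bar> + \<bar>b1\<bar>" for t using b[of t] by linarith
    then show "\<forall>\<^sub>F t in sequentially. norm (G2 t / ((real t + 1) * (real t + 2))) \<le> (\<bar>b0\<bar> + \<bar>b1\<bar>) * e t"
      by (intro always_eventually allI) (simp add: e_def abs_mult divide_right_mono)
  qed
  from tendsto_add[OF tendsto_add[OF V G0] G20] have "A \<longlonglongrightarrow> L" by (simp add: V_def)
  then show ?thesis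
  proof (rule that)
    fix t
    show "A t - L \<ge> (G t - g) / (real t + 1) + (G2 t - b1) / ((real t + 1) * (real t + 2))"
      using L_hi[of t] by (simp add: V_def e_def diff_divide_distrib)
    show "A t - L \<le> (G t - g) / (real t + 1) + (G2 t - b0) / ((real t + 1) * (real t + 2))"
      using L_lo[of t] by (simp add: V_def e_def diff_divide_distrib)
  qed
qed

section \<open>Chebyshev's kernel\<close>

lemma ln_2_bounds: "69314/100000 \<le> ln (2::real)" "ln (2::real) \<le> 69315/100000"
  using ln_approx_bounds[of 2 5] by (simp_all add: eval_nat_numeral)

lemma ln_3_bounds: "10986/10000 \<le> ln (3::real)" "ln (3::real) \<le> 109863/100000"
proof -
  have "ln (3::real) = ln 2 + ln (3/2)" by (simp add: ln_div)
  moreover have "40546/100000 \<le> ln (3/2::real)" "ln (3/2::real) \<le> 40547/100000"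
    using ln_approx_bounds[of "3/2" 3] by (simp_all add: eval_nat_numeral)
  moreover note ln_2_bounds
  ultimately show "10986/10000 \<le> ln (3::real)" "ln (3::real) \<le> 109863/100000" by simp_all
qed

lemma ln_5_bounds: "160942/100000 \<le> ln (5::real)" "ln (5::real) \<le> 160945/100000"
proof -
  have "ln (5::real) = ln 2 + ln 2 + ln (5/4)" by (simp add: ln_div ln_mult flip: ln_mult[of 2 2, simplified])
  moreover have "22314/100000 \<le> ln (5/4::real)" "ln (5/4::real) \<le> 22315/100000"
    using ln_approx_bounds[of "5/4" 3] by (simp_all add: eval_nat_numeral)
  moreover note ln_2_bounds
  ultimately show "160942/100000 \<le> ln (5::real)" "ln (5::real) \<le> 160945/100000" by simp_all
qed

section \<open>Periodic integer weights and their iterated partial sums\<close>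

definition psum :: "(nat \<Rightarrow> int) \<Rightarrow> nat \<Rightarrow> int" where
  "psum a t = (\<Sum>m\<in>{1..t}. a m)"

lemma psum_0 [simp]: "psum a 0 = 0"
  and psum_Suc: "psum a (Suc t) = psum a t + a (Suc t)"
  by (simp_all add: psum_def)

lemma psum_1 [simp]: "psum a (Suc 0) = a (Suc 0)"
  by (simp add: psum_Suc)

lemma psum_numeral: "psum a (numeral k) = psum a (pred_numeral k) + a (numeral k)"
  by (simp add: numeral_eq_Suc psum_Suc)

lemma psum_periodic:
  assumes "\<And>m. a (m + P) = a m" "psum a P = 0"
  shows "psum a (t + P) = psum a t"
proof (induction t)
  case (Suc t)
  then show ?case using assms(1)[of "Suc t"] by (simp add: psum_Suc)
qed (use assms in simp)

lemma periodic_mod: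
  fixes s :: "nat \<Rightarrow> 'a"
  assumes "\<And>t. s (t + P) = s t"
  shows "s t = s (t mod P)"
proof -
  have "s (r + q * P) = s r" for q r
  proof (induction q)
    case (Suc q)
    then show ?case using assms[of "r + q * P"] by (simp add: add_ac)
  qed simp
  from this[of "t mod P" "t div P"] show ?thesis by simp
qed

lemma All_less_numeral:
  "(\<forall>t<numeral k. P t) \<longleftrightarrow> P (pred_numeral k) \<and> (\<forall>t<pred_numeral k. P t)"
  by (auto simp: numeral_eq_Suc less_Suc_eq)

text \<open>The condition \<open>psum b P = 0\<close> says that v/u is the mean of
  \<open>psum a\<close> over a period. Multiplying by u keeps the centred sums integral, so that one
  period can be checked by evaluation.\<close>

lemma psum_periodic_bounds:
  fixes a :: "nat \<Rightarrow> int" and u v :: int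
  defines "b \<equiv> \<lambda>m. u * psum a m - v"
  assumes P: "P > 0" and per: "\<And>m. a (m + P) = a m" and zero: "psum a P = 0" "psum b P = 0"
    and small: "\<forall>t<P. psum a t \<in> {a0..a1} \<and> psum b t \<in> {b0..b1}"
  shows "psum a t = psum a (t mod P)" "psum a t \<in> {a0..a1}" "psum b t \<in> {b0..b1}"
proof -
  have a: "psum a (t + P) = psum a t" for t by (rule psum_periodic[OF per zero(1)])
  have b: "psum b (t + P) = psum b t" for t by (rule psum_periodic[OF _ zero(2)]) (simp add: b_def a)
  have "t mod P < P" using P by simp
  with small periodic_mod[of "psum a", OF a, of t] periodic_mod[of "psum b", OF b, of t]
  show "psum a t = psum a (t mod P)" "psum a t \<in> {a0..a1}" "psum b t \<in> {b0..b1}" by auto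
qed

text \<open>
  The summatory function of \<open>cheb\<close> is
  \<open>\<lfloor>t\<rfloor> - \<lfloor>t/2\<rfloor> - \<lfloor>t/3\<rfloor> - \<lfloor>t/5\<rfloor> + \<lfloor>t/30\<rfloor>\<close>.
\<close>

definition cheb :: "nat \<Rightarrow> int" where
  "cheb m = 1 - of_bool (2 dvd m) - of_bool (3 dvd m) - of_bool (5 dvd m) + of_bool (30 dvd m)"

lemma cheb_add_30: "cheb (m + 30) = cheb m"
proof -
  have "(2 dvd m + 30) = (2 dvd m)" "(3 dvd m + 30) = (3 dvd m)" "(5 dvd m + 30) = (5 dvd m)"
    "(30 dvd m + 30) = (30 dvd m)" by presburger+
  then show ?thesis by (simp only: cheb_def)
qed

lemma psum_cheb_values:
  "map (psum cheb) [1,2,3,4,5,6,7,8,9,10,11,12,13,14,15,16,17,18,19,20,21,22,23,24,25,26,27,28,29,30]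
    = [1,1,1,1,1,0,1,1,1,0,1,0,1,1,0,0,1,0,1,0,0,0,1,0,0,0,0,0,1,0]"
  by (simp add: cheb_def psum_numeral)

lemma psum_cheb_bounds: "psum cheb t \<in> {0..1}" "psum (\<lambda>m. 2 * psum cheb m - 1) t \<in> {0..8}"
proof -
  note v = psum_cheb_values[simplified list.map list.inject One_nat_def]
  have small: "\<forall>t<30. psum cheb t \<in> {0..1} \<and> psum (\<lambda>m. 2 * psum cheb m - 1) t \<in> {0..8}"
    "psum cheb 30 = 0" "psum (\<lambda>m. 2 * psum cheb m - 1) 30 = 0"
    by (simp_all add: All_less_numeral v cheb_def[of "Suc 0"] psum_numeral[of "\<lambda>m. 2 * psum cheb m - 1"])
  show "psum cheb t \<in> {0..1}" "psum (\<lambda>m. 2 * psum cheb m - 1) t \<in> {0..8}"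
    using psum_periodic_bounds(2,3)[of 30 cheb, OF _ cheb_add_30 small(2,3,1)] by simp_all
qed

lemma sum_multiples:
  fixes h :: "nat \<Rightarrow> real"
  assumes j: "j > 0"
  shows "(\<Sum>m\<in>{1..t}. of_bool (j dvd m) * h m) = (\<Sum>i\<in>{1..t div j}. h (j * i))"
proof -
  have "(\<Sum>m\<in>{1..t}. of_bool (j dvd m) * h m) = (\<Sum>m\<in>{m\<in>{1..t}. j dvd m}. h m)"
    by (simp add: Int_def)
  also have "\<dots> = (\<Sum>i\<in>{1..t div j}. h (j * i))"
    using j by (intro sum.reindex_bij_witness[of _ "\<lambda>i. j * i" "\<lambda>m. m div j"])
      (auto simp: less_eq_div_iff_mult_less_eq mult.commute div_le_mono Suc_le_eq elim!: dvdE)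
  finally show ?thesis .
qed

lemma sum_cheb_mult:
  fixes h :: "nat \<Rightarrow> real"
  assumes mult: "\<And>m n. h (m * n) = h m * h n"
  defines "S \<equiv> \<lambda>t. \<Sum>m\<in>{1..t}. h m"
  shows "(\<Sum>m\<in>{1..t}. of_int (cheb m) * h m) = h 1 * S t - h 2 * S (t div 2) - h 3 * S (t div 3)
     - h 5 * S (t div 5) + h 30 * S (t div 30)"
proof -
  have j: "(\<Sum>m\<in>{1..t}. of_bool (j dvd m) * h m) = h j * S (t div j)" if "j > 0" for j t
    using that by (subst sum_multiples) (simp_all add: mult S_def sum_distrib_left)
  have h1: "h 1 * h m = h m" for m using mult[of 1 m] by simp
  have "h 1 * S t = (\<Sum>m\<in>{1..t}. h m)"
    unfolding S_def sum_distrib_left by (intro sum.cong refl h1)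
  moreover have "(\<Sum>m\<in>{1..t}. of_int (cheb m) * h m) = (\<Sum>m\<in>{1..t}. h m) - (\<Sum>m\<in>{1..t}. of_bool (2 dvd m) * h m)
     - (\<Sum>m\<in>{1..t}. of_bool (3 dvd m) * h m) - (\<Sum>m\<in>{1..t}. of_bool (5 dvd m) * h m)
     + (\<Sum>m\<in>{1..t}. of_bool (30 dvd m) * h m)"
    unfolding sum.distrib[symmetric] sum_subtractf[symmetric]
    by (rule sum.cong) (simp_all only: cheb_def of_int_add of_int_diff of_int_1 of_int_of_bool ring_distribs mult_1)
  ultimately show ?thesis by (simp only: j zero_less_numeral)
qed

text \<open>Serves twice: with h = 1 it gives factorials and the bound for \<open>psi\<close>, with
  h(m) = 1/m it gives the recurrence for the sum of \<open>mangoldt n / n\<close>.\<close>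

lemma sum_mangoldt_cheb:
  fixes h :: "nat \<Rightarrow> real"
  assumes mult: "\<And>m n. h (m * n) = h m * h n"
  defines "U \<equiv> \<lambda>n. \<Sum>k\<in>{1..n}. h k * ln (real k)"
  shows "(\<Sum>d\<in>{1..N}. mangoldt d * h d * (\<Sum>m\<in>{1..N div d}. of_int (cheb m) * h m))
    = h 1 * U N - h 2 * U (N div 2) - h 3 * U (N div 3) - h 5 * U (N div 5) + h 30 * U (N div 30)"
proof -
  define S where "S t = (\<Sum>m\<in>{1..t}. h m)" for t
  have U: "(\<Sum>d\<in>{1..N}. mangoldt d * h d * S (N div d div j)) = U (N div j)" if "j > 0" for j
    using that sum_mangoldt_mult[OF mult, of "N div j"]
    by (subst sum_div_restrict) (auto simp: S_def U_def)
  have "(\<Sum>d\<in>{1..N}. mangoldt d * h d * (\<Sum>m\<in>{1..N div d}. of_int (cheb m) * h m))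
   = (\<Sum>d\<in>{1..N}. h 1 * (mangoldt d * h d * S (N div d div 1)) - h 2 * (mangoldt d * h d * S (N div d div 2))
    - h 3 * (mangoldt d * h d * S (N div d div 3)) - h 5 * (mangoldt d * h d * S (N div d div 5))
    + h 30 * (mangoldt d * h d * S (N div d div 30)))"
    unfolding sum_cheb_mult[OF mult] S_def[symmetric]
    by (rule sum.cong) (simp_all only: ring_distribs mult_ac div_by_1)
  also have "\<dots> = h 1 * U (N div 1) - h 2 * U (N div 2) - h 3 * U (N div 3) - h 5 * U (N div 5) + h 30 * U (N div 30)"
    by (simp only: sum.distrib sum_subtractf sum_distrib_left[symmetric] U zero_less_numeral zero_less_one)
  finally show ?thesis by simp
qed

section \<open>Logarithms of factorials and Chebyshev's bound for psi\<close>

lemma ln_fact_bounds: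
  assumes "n > 0"
  shows "real n * ln n - n \<le> ln (fact n)" "ln (fact n) \<le> real n * ln n - n + ln n + 1"
proof -
  have "real n * ln n - n \<le> ln (fact n) \<and> ln (fact n) \<le> real n * ln n - n + ln n + 1"
    using assms
  proof (induction n rule: nat_induct_non_zero)
    case (Suc n)
    define x where "x = real n"
    have x: "x > 0" using Suc by (simp add: x_def)
    have f: "ln (fact (Suc n) :: real) = ln (x + 1) + ln (fact n)"
      by (simp add: ln_mult x_def add.commute)
    have d: "ln (x + 1) - ln x = ln (1 + 1 / x)" using x ln_div[of "x + 1" x] by (simp add: add_divide_distrib)
    have "ln (1 + 1 / x) \<le> 1 / x" using x by (intro ln_add_one_self_le_self) auto
    then have 1: "x * (ln (x + 1) - ln x) \<le> 1" unfolding d using x by (simp add: field_simps)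
    have "ln x - ln (x + 1) \<le> x / (x + 1) - 1"
      using ln_le_minus_one[of "x / (x + 1)"] x by (simp add: ln_div)
    also have "\<dots> = - (1 / (x + 1))" using x by (simp add: field_simps)
    finally have "1 / (x + 1) \<le> ln (x + 1) - ln x" by simp
    then have 2: "1 \<le> (x + 1) * (ln (x + 1) - ln x)" using x by (simp add: field_simps)
    from Suc.IH 1 2 show ?case
      unfolding f of_nat_Suc x_def[symmetric] by (simp add: algebra_simps)
  qed simp
  then show "real n * ln n - n \<le> ln (fact n)" "ln (fact n) \<le> real n * ln n - n + ln n + 1" by auto
qed

lemma div_real_bounds:
  assumes "j > 0"
  shows "real (N div j) \<le> real N / real j" "real N / real j < real (N div j) + 1"
proof -
  have "N div j * j \<le> N" by simp
  then show "real (N div j) \<le> real N / real j"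
    using assms by (simp add: pos_le_divide_eq flip: of_nat_mult)
  have "N < j + j * (N div j)" using assms by (rule dividend_less_times_div)
  then have "real N < real (j + j * (N div j))" by (subst of_nat_less_iff)
  then show "real N / real j < real (N div j) + 1"
    using assms by (simp add: field_simps)
qed

text \<open>The function t ln t - t has derivative ln t, so replacing the floor by y itself costs at
  most one ln y in the lower bound; the upper bound is monotone and costs nothing.\<close>

lemma ln_fact_div_bounds:
  assumes "j > 0" "j \<le> N"
  defines "y \<equiv> real N / real j"
  shows "y * ln y - y - ln y \<le> ln (fact (N div j))" "ln (fact (N div j)) \<le> y * ln y - y + ln y + 1"
proof -
  define M where "M = real (N div j)"
  have M: "M \<ge> 1" using assms by (simp add: M_def div_greater_zero_iff Suc_le_eq)
  have y: "M \<le> y" "y < M + 1" using div_real_bounds[OF assms(1), of N] by (auto simp: M_def y_def)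
  have d: "ln y - ln M = ln (y / M)" using y M by (simp add: ln_div)
  have "ln (y / M) \<le> y / M - 1" using y M by (intro ln_le_minus_one) auto
  then have 1: "M * (ln y - ln M) \<le> y - M" using M unfolding d by (simp add: field_simps)
  have "ln (M / y) \<le> M / y - 1" using y M by (intro ln_le_minus_one) auto
  then have 2: "y * (ln y - ln M) \<ge> y - M" using M y by (simp add: field_simps ln_div)
  have 3: "(y - M) * ln y \<le> 1 * ln y" "(y - M) * ln M \<ge> 0"
    using y M by (intro mult_right_mono mult_nonneg_nonneg ln_ge_zero; simp)+
  have 4: "ln M \<le> ln y" using y M by simp
  have "real (N div j) * ln (real (N div j)) - N div j \<le> ln (fact (N div j))"
       "ln (fact (N div j)) \<le> real (N div j) * ln (real (N div j)) - N div j + ln (real (N div j)) + 1"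
    using M by (intro ln_fact_bounds; simp add: M_def)+
  with 1 2 3 4 show "y * ln y - y - ln y \<le> ln (fact (N div j))" "ln (fact (N div j)) \<le> y * ln y - y + ln y + 1"
    unfolding M_def[symmetric] by (auto simp: algebra_simps)
qed

definition cheb_const :: real where
  "cheb_const = ln 2 / 2 + ln 3 / 3 + ln 5 / 5 - ln 30 / 30"

lemma ln_30: "ln (30::real) = ln 2 + ln 3 + ln 5"
  using ln_mult[of "2*3" "5::real"] ln_mult[of 2 "3::real"] by simp

lemma cheb_const_bounds: "92127/100000 \<le> cheb_const" "cheb_const \<le> 9214/10000"
  using ln_2_bounds ln_3_bounds ln_5_bounds unfolding cheb_const_def ln_30 by argo+

text \<open>Chebyshev's argument: the summatory kernel takes only the values 0 and 1 and equals 1 on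
  1..5, so it dominates the indicator of d > \<open>N div 6\<close>. In the resulting combination of
  five factorials the terms N ln N and N cancel, and each factorial contributes one ln N to the
  error.\<close>

lemma psi_diff_le:
  assumes N: "N \<ge> 30"
  shows "psi N - psi (N div 6) \<le> cheb_const * real N + 5 * ln (real N) - 4"
proof -
  have U: "(\<Sum>k\<in>{1..n}. ln (real k)) = ln (fact n)" for n
    unfolding fact_prod of_nat_prod by (subst ln_prod) auto
  have "psi N - psi (N div 6) = (\<Sum>d\<in>{1..N}. mangoldt d - (if 6 \<le> N div d then mangoldt d else 0))"
    using sum_div_indicator[of 6 N mangoldt] by (simp add: psi_def sum_subtractf)
  also have "\<dots> \<le> (\<Sum>d\<in>{1..N}. mangoldt d * of_int (psum cheb (N div d)))"
  proof (rule sum_mono)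
    fix d assume d: "d \<in> {1..N}"
    then have "N div d > 0" by (auto simp: div_greater_zero_iff)
    show "(mangoldt d :: real) - (if 6 \<le> N div d then mangoldt d else 0) \<le> mangoldt d * of_int (psum cheb (N div d))"
    proof (cases "6 \<le> N div d")
      case True
      then show ?thesis using psum_cheb_bounds(1)[of "N div d"] by (auto simp: mangoldt_nonneg)
    next
      case False
      then have "N div d \<in> {Suc 0,2,3,4,5}" using \<open>N div d > 0\<close> by auto
      then have "psum cheb (N div d) = 1" by (auto simp: cheb_def psum_numeral)
      then show ?thesis using False by simp
    qed
  qed
  also have "\<dots> = ln (fact N) - ln (fact (N div 2)) - ln (fact (N div 3)) - ln (fact (N div 5)) + ln (fact (N div 30))"
    using sum_mangoldt_cheb[of "\<lambda>_. 1" N] by (simp add: psum_def U[unfolded One_nat_def])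
  also have "\<dots> \<le> cheb_const * real N + 5 * ln (real N) - 2 * ln 30 + 2"
  proof -
    have "ln (real N / real j) = ln (real N) - ln (real j)" if "j > 0" for j using that N by (simp add: ln_div)
    note l = this[of 2] this[of 3] this[of 5] this[of 30]
    define x where "x = real N"
    define l where "l = ln x"
    have "ln (fact N) \<le> x * l - x + l + 1"
      using ln_fact_div_bounds(2)[of 1 N] N by (simp add: x_def l_def)
    moreover have "ln (fact (N div 30)) \<le> x / 30 * (l - ln 30) - x / 30 + (l - ln 30) + 1"
      using ln_fact_div_bounds(2)[of 30 N] N l by (simp add: x_def l_def)
    moreover have "x / 2 * (l - ln 2) - x / 2 - (l - ln 2) \<le> ln (fact (N div 2))"
      using ln_fact_div_bounds(1)[of 2 N] N l by (simp add: x_def l_def)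
    moreover have "x / 3 * (l - ln 3) - x / 3 - (l - ln 3) \<le> ln (fact (N div 3))"
      using ln_fact_div_bounds(1)[of 3 N] N l by (simp add: x_def l_def)
    moreover have "x / 5 * (l - ln 5) - x / 5 - (l - ln 5) \<le> ln (fact (N div 5))"
      using ln_fact_div_bounds(1)[of 5 N] N l by (simp add: x_def l_def)
    moreover have "x * l - x + l + 1 + (x / 30 * (l - ln 30) - x / 30 + (l - ln 30) + 1)
      - (x / 2 * (l - ln 2) - x / 2 - (l - ln 2)) - (x / 3 * (l - ln 3) - x / 3 - (l - ln 3))
      - (x / 5 * (l - ln 5) - x / 5 - (l - ln 5)) = cheb_const * x + 5 * l - 2 * ln 30 + 2"
      by (simp add: cheb_const_def ln_30 field_simps)
    ultimately show ?thesis unfolding x_def[symmetric] l_def[symmetric] by argo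
  qed
  finally show ?thesis using ln_2_bounds ln_3_bounds ln_5_bounds by (simp add: ln_30)
qed

lemma ln_1000: "ln (1000::real) = 3 * ln 2 + 3 * ln 5"
  using ln_realpow[of 10 3] ln_mult[of 2 "5::real"] by simp

lemma ln_le_1000:
  assumes "x \<ge> (1000::real)"
  shows "ln x \<le> 6908/1000 + (x - 1000) / 1000"
proof -
  have "ln x - ln 1000 = ln (x / 1000)" using assms by (simp add: ln_div)
  also have "\<dots> \<le> x / 1000 - 1" using assms by (intro ln_le_minus_one) auto
  finally show ?thesis using ln_2_bounds ln_5_bounds unfolding ln_1000 by argo
qed

text \<open>Iterating N -> N/6 would give the ratio 6/5 * 0.9214, below 1.106. The room up to 1.15
  absorbs the term 5 ln N as soon as N >= 1000.\<close>

lemma psi_le: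
  assumes base: "\<And>n. n < 1000 \<Longrightarrow> psi n \<le> 115/100 * real n"
  shows "psi n \<le> 115/100 * real n"
proof (induction n rule: less_induct)
  case (less N)
  show ?case
  proof (cases "N < 1000")
    case False
    then have N: "real N \<ge> 1000" by simp
    have "psi (N div 6) \<le> 115/100 * real (N div 6)" using N by (intro less) auto
    also have "\<dots> \<le> 115/100 * (real N / 6)" using div_real_bounds[of 6 N] by simp
    finally have "psi N \<le> 115/100 * (real N / 6) + (cheb_const * real N + 5 * ln (real N) - 4)"
      using psi_diff_le[of N] N by simp
    moreover have "cheb_const * real N \<le> 9214/10000 * real N"
      using cheb_const_bounds by (intro mult_right_mono) auto
    ultimately show ?thesis using ln_le_1000[OF N] N by argo
  qed (use base in auto)
qed

section \<open>The sum of \<open>\<Lambda>(n)/n\<close>\<close>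

definition ln_sum :: "nat \<Rightarrow> real" where
  "ln_sum n = (\<Sum>k\<in>{1..n}. ln (real k) / real k)"

text \<open>The mean value theorem for (ln t)^2/2, whose derivative ln t / t decreases from e on;
  this explains the bound 3.\<close>

lemma half_ln_square_diff:
  fixes x y :: real
  assumes "3 \<le> x" "x \<le> y"
  shows "(y - x) * (ln y / y) \<le> (ln y)\<^sup>2 / 2 - (ln x)\<^sup>2 / 2" "(ln y)\<^sup>2 / 2 - (ln x)\<^sup>2 / 2 \<le> (y - x) * (ln x / x)"
proof -
  have "(y - x) * (ln y / y) \<le> (ln y)\<^sup>2 / 2 - (ln x)\<^sup>2 / 2 \<and> (ln y)\<^sup>2 / 2 - (ln x)\<^sup>2 / 2 \<le> (y - x) * (ln x / x)"
  proof (cases "x = y")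
    case False
    with assms have "x < y" by simp
    have "\<exists>z. x < z \<and> z < y \<and> (ln y)\<^sup>2 / 2 - (ln x)\<^sup>2 / 2 = (y - x) * (ln z / z)"
      using assms by (intro MVT2[OF \<open>x < y\<close>]) (auto intro!: derivative_eq_intros)
    then obtain z where z: "x < z" "z < y" "(ln y)\<^sup>2 / 2 - (ln x)\<^sup>2 / 2 = (y - x) * (ln z / z)" by blast
    have e: "exp 1 \<le> x" using exp_le assms by linarith
    have "ln z / z \<le> ln x / x" using ln_x_over_x_mono[of x z] e z by simp
    moreover have "ln y / y \<le> ln z / z" using ln_x_over_x_mono[of z y] e z by simp
    ultimately show ?thesis unfolding z(3) using \<open>x < y\<close> by (intro conjI mult_left_mono) auto
  qed simp
  then show "(y - x) * (ln y / y) \<le> (ln y)\<^sup>2 / 2 - (ln x)\<^sup>2 / 2" "(ln y)\<^sup>2 / 2 - (ln x)\<^sup>2 / 2 \<le> (y - x) * (ln x / x)"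
    by auto
qed

lemma ln_sum_diff:
  assumes "3 \<le> m" "m \<le> n"
  defines "D \<equiv> \<lambda>k. ln_sum k - (ln (real k))\<^sup>2 / 2"
  shows "D n \<le> D m" "D m \<le> D n + ln (real m) / real m"
proof -
  \<comment> \<open>Strengthened for the induction: D decreases while D(k) - ln k / k
    increases.\<close>
  have "D n \<le> D m \<and> D m + ln (real n) / real n \<le> D n + ln (real m) / real m"
    using assms(2)
  proof (induction n rule: dec_induct)
    case (step n)
    have n: "real n \<ge> 3" using step assms(1) by simp
    have s: "ln_sum (Suc n) = ln_sum n + ln (real n + 1) / (real n + 1)" by (simp add: ln_sum_def add.commute)
    from half_ln_square_diff[of "real n" "real n + 1"] n step.IH show ?case
      unfolding D_def s by (simp add: add.commute)
  qed simp
  moreover have "ln (real n) / real n \<ge> 0" using assms by simp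
  ultimately show "D n \<le> D m" "D m \<le> D n + ln (real m) / real m" by auto
qed

text \<open>With n = \<open>N div j\<close>, rounding y down to n and passing from n to N both
  change the value by an amount between 0 and ln n / n. They enter with opposite signs, so a single
  ln M / M covers both.\<close>

lemma ln_sum_div:
  assumes "j > 0" "real N / real j \<ge> real M" "M \<ge> 3"
  defines "y \<equiv> real N / real j"
  shows "\<bar>ln_sum (N div j) - (ln y)\<^sup>2 / 2 - (ln_sum N - (ln (real N))\<^sup>2 / 2)\<bar> \<le> ln (real M) / real M"
proof -
  define n where "n = N div j"
  have "M * j \<le> N" using assms(1,2) by (simp add: field_simps flip: of_nat_mult)
  then have M: "M \<le> n" using assms(1) by (simp add: n_def less_eq_div_iff_mult_less_eq)
  have y: "real n \<le> y" "y < real n + 1" using div_real_bounds[OF assms(1), of N] by (auto simp: n_def y_def)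
  have n3: "real n \<ge> 3" using M assms(3) by simp
  have l: "ln (real n) / real n \<ge> 0" using n3 by simp
  have "(ln y)\<^sup>2 / 2 - (ln (real n))\<^sup>2 / 2 \<le> (y - real n) * (ln (real n) / real n)"
       "(y - real n) * (ln y / y) \<le> (ln y)\<^sup>2 / 2 - (ln (real n))\<^sup>2 / 2"
    using half_ln_square_diff[of "real n" y] y n3 by auto
  moreover have "(y - real n) * (ln (real n) / real n) \<le> 1 * (ln (real n) / real n)"
    using y l by (intro mult_right_mono) auto
  moreover have "(y - real n) * (ln y / y) \<ge> 0" using y n3 by simp
  moreover note ln_sum_diff[of n N]
  moreover have "n \<le> N" by (simp add: n_def)
  moreover have "ln (real n) / real n \<le> ln (real M) / real M"
    using M assms(3) exp_le by (intro ln_x_over_x_mono) auto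
  ultimately show ?thesis using n3 unfolding n_def[symmetric] by (simp add: abs_le_iff)
qed

definition cheb_const2 :: real where
  "cheb_const2 = ((ln 30)\<^sup>2 / 30 - (ln 2)\<^sup>2 / 2 - (ln 3)\<^sup>2 / 3 - (ln 5)\<^sup>2 / 5) / 2"

text \<open>With l = ln N, both l^2/2 and the unknown offset D have total weight 1 - 1/2 - 1/3 - 1/5
  + 1/30 = 0; the mixed terms give \<open>cheb_const * l\<close> and the squares of the logarithms
  give \<open>cheb_const2\<close>. The numbers 500, 333, 200 and 33 are lower bounds for N/j, and
  the four errors add up to just under 0.021.\<close>

lemma ln_sum_cheb:
  assumes N: "N \<ge> 1000"
  shows "\<bar>ln_sum N - ln_sum (N div 2) / 2 - ln_sum (N div 3) / 3 - ln_sum (N div 5) / 5 + ln_sum (N div 30) / 30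
     - (cheb_const * ln (real N) + cheb_const2)\<bar> \<le> 21/1000"
proof -
  define l where "l = ln (real N)"
  define D where "D = ln_sum N - l\<^sup>2 / 2"
  have nz: "real N > 0" using N by simp
  have l: "ln (real N / 2) = l - ln 2" "ln (real N / 3) = l - ln 3" "ln (real N / 5) = l - ln 5" "ln (real N / 30) = l - ln 30"
    using nz by (simp_all add: ln_div l_def)
  have p2: "ln 500 \<le> 2 * ln 2 + 3 * ln (5::real)" using ln_realpow[of 5 3] ln_realpow[of 2 2] ln_mult[of 4 "125::real"] by simp
  have "ln (333::real) \<le> ln (1000/3)" by simp
  then have p3: "ln 333 \<le> 3 * ln 2 + 3 * ln 5 - ln (3::real)" by (simp add: ln_div ln_1000)
  have p5: "ln 200 \<le> 3 * ln 2 + 2 * ln (5::real)" using ln_realpow[of 5 2] ln_realpow[of 2 3] ln_mult[of 8 "25::real"] by simp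
  have "ln (33::real) \<le> ln (100/3)" by simp
  also have "ln (100/3) = 2 * ln 2 + 2 * ln 5 - ln (3::real)"
    using ln_realpow[of 5 2] ln_realpow[of 2 2] ln_mult[of 4 "25::real"] by (simp add: ln_div)
  finally have p30: "ln 33 \<le> 2 * ln 2 + 2 * ln 5 - ln (3::real)" .
  have "\<bar>ln_sum (N div 2) - (l - ln 2)\<^sup>2 / 2 - D\<bar> \<le> ln 500 / 500"
    using ln_sum_div[of 2 500 N] N by (simp add: l D_def l_def[symmetric])
  moreover have "\<bar>ln_sum (N div 3) - (l - ln 3)\<^sup>2 / 2 - D\<bar> \<le> ln 333 / 333"
    using ln_sum_div[of 3 333 N] N by (simp add: l D_def l_def[symmetric])
  moreover have "\<bar>ln_sum (N div 5) - (l - ln 5)\<^sup>2 / 2 - D\<bar> \<le> ln 200 / 200"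
    using ln_sum_div[of 5 200 N] N by (simp add: l D_def l_def[symmetric])
  moreover have "\<bar>ln_sum (N div 30) - (l - ln 30)\<^sup>2 / 2 - D\<bar> \<le> ln 33 / 33"
    using ln_sum_div[of 30 33 N] N by (simp add: l D_def l_def[symmetric])
  moreover have "l\<^sup>2 / 2 - ((l - ln 2)\<^sup>2 / 2) / 2 - ((l - ln 3)\<^sup>2 / 2) / 3 - ((l - ln 5)\<^sup>2 / 2) / 5 + ((l - ln 30)\<^sup>2 / 2) / 30
      = cheb_const * l + cheb_const2"
    by (simp add: cheb_const_def cheb_const2_def power2_eq_square field_simps)
  moreover have "ln_sum N = D + l\<^sup>2 / 2" by (simp add: D_def)
  ultimately show ?thesis
    using p2 p3 p5 p30 ln_2_bounds ln_3_bounds ln_5_bounds unfolding l_def[symmetric] abs_le_iff by linarith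
qed

section \<open>Limit and tail of Chebyshev's kernel\<close>

lemma cheb_sum_inverse:
  "(\<Sum>m\<in>{1..t}. of_int (cheb m) / real m) = harm t - harm (t div 2) / 2 - harm (t div 3) / 3
     - harm (t div 5) / 5 + harm (t div 30) / 30"
  using sum_cheb_mult[of "\<lambda>m. 1 / real m" t] by (simp add: harm_def inverse_eq_divide)

text \<open>Along multiples of 30 all floors are exact. Writing harmonic numbers as ln n + E(n), the
  logarithms combine to \<open>cheb_const\<close>, and the Euler--Mascheroni constant drops out
  because its total weight is zero.\<close>

lemma cheb_limit:
  assumes "(\<lambda>t. \<Sum>m\<in>{1..t}. of_int (cheb m) / real m) \<longlonglongrightarrow> L"
  shows "L = cheb_const"
proof -
  define E where "E n = harm n - ln (real n)" for n :: nat
  have E: "E \<longlonglongrightarrow> euler_mascheroni" unfolding E_def by (rule euler_mascheroni_LIMSEQ)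
  have sub: "(\<lambda>k. E (j * k)) \<longlonglongrightarrow> euler_mascheroni" if "j > 0" for j
    using that by (intro LIMSEQ_subseq_LIMSEQ[OF E, unfolded o_def]) (auto simp: strict_mono_def)
  have "(\<lambda>k. E (30 * k) - E (15 * k) / 2 - E (10 * k) / 3 - E (6 * k) / 5 + E (1 * k) / 30 + cheb_const)
     \<longlonglongrightarrow> euler_mascheroni - euler_mascheroni / 2 - euler_mascheroni / 3 - euler_mascheroni / 5
       + euler_mascheroni / 30 + cheb_const"
    by (intro tendsto_intros sub) auto
  then have "(\<lambda>k. E (30 * k) - E (15 * k) / 2 - E (10 * k) / 3 - E (6 * k) / 5 + E (1 * k) / 30 + cheb_const) \<longlonglongrightarrow> cheb_const"
    by simp
  moreover have "\<forall>\<^sub>F k in sequentially. E (30 * k) - E (15 * k) / 2 - E (10 * k) / 3 - E (6 * k) / 5 + E (1 * k) / 30 + cheb_const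
     = (\<Sum>m\<in>{1..30 * k}. of_int (cheb m) / real m)"
    using eventually_gt_at_top[of 0]
  proof eventually_elim
    case (elim k)
    have d: "30 * k div 2 = 15 * k" "30 * k div 3 = 10 * k" "30 * k div 5 = 6 * k" "30 * k div 30 = k" by auto
    have l: "ln (30 * real k) = ln 2 + ln 3 + ln 5 + ln (real k)" "ln (15 * real k) = ln 3 + ln 5 + ln (real k)"
      "ln (10 * real k) = ln 2 + ln 5 + ln (real k)" "ln (6 * real k) = ln 2 + ln 3 + ln (real k)"
      using elim ln_30 ln_mult[of 3 "5::real"] ln_mult[of 2 "5::real"] ln_mult[of 2 "3::real"] by (simp_all add: ln_mult)
    show ?case
      unfolding cheb_sum_inverse d E_def cheb_const_def ln_30 of_nat_mult of_nat_numeral of_nat_1 mult_1 l by argo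
  qed
  ultimately have "(\<lambda>k. \<Sum>m\<in>{1..30 * k}. of_int (cheb m) / real m) \<longlonglongrightarrow> cheb_const"
    by (rule Lim_transform_eventually)
  moreover have "(\<lambda>k. \<Sum>m\<in>{1..30 * k}. of_int (cheb m) / real m) \<longlonglongrightarrow> L"
    by (rule LIMSEQ_subseq_LIMSEQ[OF assms, unfolded o_def]) (auto simp: strict_mono_def)
  ultimately show ?thesis using LIMSEQ_unique by blast
qed

lemma abs_mult_le:
  fixes x w s :: real
  assumes "l \<le> x" "x \<le> u" "u * s \<le> c" "- c \<le> l * s" "s \<ge> 0"
  shows "\<bar>x\<bar> * s \<le> c"
proof -
  have "x * s \<le> u * s" "l * s \<le> x * s" using assms by (auto intro!: mult_right_mono)
  then show ?thesis using assms by (cases "x \<ge> 0") auto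
qed

lemma mult_add_divide_scale:
  fixes U s r :: real
  assumes "U > 0" "s > 0" "r > 0"
  shows "(p / (U * s) + q / (U * s * r)) * s = (p + q / r) / U"
  using assms by (simp add: distrib_right add_divide_distrib)

text \<open>\<open>twice_summed_limit\<close> with mean g = v/u and integer data. The two one-sided
  bounds locate L numerically from a single partial sum; the absolute bound is the decay required by
  \<open>msum_hyperbola_approx\<close>.\<close>

lemma periodic_tail:
  fixes a :: "nat \<Rightarrow> int" and u v b0 b1 a0 a1 :: int
  assumes u: "u > 0" and b: "\<And>t. psum (\<lambda>m. u * psum a m - v) t \<in> {b0..b1}" and a: "\<And>t. psum a t \<in> {a0..a1}"
  defines "A \<equiv> \<lambda>t. \<Sum>m\<in>{1..t}. of_int (a m) / real m"
  obtains L where "A \<longlonglongrightarrow> L"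
    "\<And>t. \<bar>A t - L\<bar> * (real t + 1) \<le> (max (of_int (u * a1 - v)) (of_int (v - u * a0)) + of_int (b1 - b0) / (real t + 2)) / of_int u"
    "\<And>t. A t - L \<ge> of_int (u * psum a t - v) / (of_int u * (real t + 1)) + of_int (psum (\<lambda>m. u * psum a m - v) t - b1) / (of_int u * (real t + 1) * (real t + 2))"
    "\<And>t. A t - L \<le> of_int (u * psum a t - v) / (of_int u * (real t + 1)) + of_int (psum (\<lambda>m. u * psum a m - v) t - b0) / (of_int u * (real t + 1) * (real t + 2))"
proof -
  define U where "U = real_of_int u"
  have U: "U > 0" using u by (simp add: U_def)
  define g where "g = of_int v / U"
  have G: "(\<Sum>m\<in>{1..t}. real_of_int (a m)) = of_int (psum a t)" for t by (simp add: psum_def)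
  have "real_of_int (psum (\<lambda>m. u * psum a m - v) t) = (\<Sum>m\<in>{1..t}. U * (of_int (psum a m) - g))" for t
    unfolding psum_def[of "\<lambda>m. u * psum a m - v"] using U by (simp add: U_def g_def right_diff_distrib)
  also have "(\<Sum>m\<in>{1..t}. U * (of_int (psum a m) - g)) = U * (\<Sum>m\<in>{1..t}. of_int (psum a m) - g)" for t
    by (simp add: sum_distrib_left)
  finally have G2: "(\<Sum>m\<in>{1..t}. of_int (psum a m) - g) = of_int (psum (\<lambda>m. u * psum a m - v) t) / U" for t
    using U by (simp add: field_simps)
  have Gg: "of_int (psum a t) - g = of_int (u * psum a t - v) / U" for t
    using U by (simp add: g_def U_def field_simps)
  have A_eq: "(\<Sum>m\<in>{1..t}. of_int (a m) / real m) = A t" for t by (simp add: A_def)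
  have bb: "of_int b0 / U \<le> (\<Sum>m\<in>{1..t}. (\<Sum>m\<in>{1..m}. real_of_int (a m)) - g)"
           "(\<Sum>m\<in>{1..t}. (\<Sum>m\<in>{1..m}. real_of_int (a m)) - g) \<le> of_int b1 / U" for t
    unfolding G G2 using b[of t] U by (simp_all only: divide_right_mono of_int_le_iff atLeastAtMost_iff less_imp_le)
  obtain L where L: "A \<longlonglongrightarrow> L"
    and L1: "A t - L \<ge> (of_int (u * psum a t - v) / U) / (real t + 1) + (of_int (psum (\<lambda>m. u * psum a m - v) t) / U - of_int b1 / U) / ((real t + 1) * (real t + 2))"
    and L2: "A t - L \<le> (of_int (u * psum a t - v) / U) / (real t + 1) + (of_int (psum (\<lambda>m. u * psum a m - v) t) / U - of_int b0 / U) / ((real t + 1) * (real t + 2))" for t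
    by (rule twice_summed_limit[OF bb, unfolded G, unfolded G2, unfolded Gg A_eq]) (rule that)
  show ?thesis
  proof (rule that[OF L])
    fix t
    let ?x = "A t - L"
    define s where "s = real t + 1"
    have s: "s > 0" by (simp add: s_def)
    define p q where "p = u * psum a t - v" and "q = psum (\<lambda>m. u * psum a m - v) t"
    show 1: "?x \<ge> of_int (u * psum a t - v) / (of_int u * (real t + 1)) + of_int (psum (\<lambda>m. u * psum a m - v) t - b1) / (of_int u * (real t + 1) * (real t + 2))"
      using L1[of t] u by (simp add: U_def diff_divide_distrib mult.assoc)
    show 2: "?x \<le> of_int (u * psum a t - v) / (of_int u * (real t + 1)) + of_int (psum (\<lambda>m. u * psum a m - v) t - b0) / (of_int u * (real t + 1) * (real t + 2))"
      using L2[of t] u by (simp add: U_def diff_divide_distrib mult.assoc)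
    have p: "real_of_int p \<le> of_int (u * a1 - v)" "- real_of_int p \<le> of_int (v - u * a0)"
      using a[of t] u by (auto simp: p_def simp flip: of_int_minus intro!: mult_left_mono)
    have q: "real_of_int (q - b0) \<le> of_int (b1 - b0)" "real_of_int (b1 - q) \<le> of_int (b1 - b0)"
      using b[of t] by (auto simp: q_def)
    show "\<bar>?x\<bar> * (real t + 1) \<le> (max (of_int (u * a1 - v)) (of_int (v - u * a0)) + of_int (b1 - b0) / (real t + 2)) / of_int u"
    proof (rule abs_mult_le[OF 1 2])
      have "(of_int p / (U * s) + of_int (q - b0) / (U * s * (s + 1))) * s = (of_int p + of_int (q - b0) / (s + 1)) / U"
        using s U by (intro mult_add_divide_scale) auto
      also have "\<dots> \<le> (max (of_int (u * a1 - v)) (of_int (v - u * a0)) + of_int (b1 - b0) / (s + 1)) / U"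
        using p q U s by (intro divide_right_mono add_mono) (auto simp: le_max_iff_disj intro!: divide_right_mono)
      finally show "(of_int (u * psum a t - v) / (of_int u * (real t + 1)) + of_int (psum (\<lambda>m. u * psum a m - v) t - b0) / (of_int u * (real t + 1) * (real t + 2))) * (real t + 1)
         \<le> (max (of_int (u * a1 - v)) (of_int (v - u * a0)) + of_int (b1 - b0) / (real t + 2)) / of_int u"
        by (simp add: s_def p_def q_def U_def add_ac)
      have "- ((of_int p / (U * s) + of_int (q - b1) / (U * s * (s + 1))) * s) = (- of_int p + of_int (b1 - q) / (s + 1)) / U"
        using s U by (subst mult_add_divide_scale) (auto simp: minus_divide_left diff_divide_distrib)
      also have "\<dots> \<le> (max (of_int (u * a1 - v)) (of_int (v - u * a0)) + of_int (b1 - b0) / (s + 1)) / U"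
        using p q U s by (intro divide_right_mono add_mono) (auto simp: le_max_iff_disj intro!: divide_right_mono)
      finally show "- ((max (of_int (u * a1 - v)) (of_int (v - u * a0)) + of_int (b1 - b0) / (real t + 2)) / of_int u)
         \<le> (of_int (u * psum a t - v) / (of_int u * (real t + 1)) + of_int (psum (\<lambda>m. u * psum a m - v) t - b1) / (of_int u * (real t + 1) * (real t + 2))) * (real t + 1)"
        by (simp add: s_def p_def q_def U_def add_ac)
    qed simp
  qed
qed

lemma cheb_tail:
  assumes "t > 5"
  shows "\<bar>(\<Sum>m\<in>{1..t}. of_int (cheb m) / real m) - cheb_const\<bar> * (real t + 1) \<le> 5/8"
proof -
  define A where "A t = (\<Sum>m\<in>{1..t}. of_int (cheb m) / real m)" for t
  obtain L where lim: "(\<lambda>t. \<Sum>m\<in>{1..t}. of_int (cheb m) / real m) \<longlonglongrightarrow> L"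
    and L: "\<And>t. \<bar>(\<Sum>m\<in>{1..t}. of_int (cheb m) / real m) - L\<bar> * (real t + 1)
       \<le> (max (of_int (2 * 1 - 1)) (of_int (1 - 2 * 0)) + of_int (8 - 0) / (real t + 2)) / of_int 2"
    by (rule periodic_tail[OF zero_less_numeral psum_cheb_bounds(2,1)]) (rule that; assumption)
  from cheb_limit[OF lim] have L_eq: "L = cheb_const" .
  have A: "A 0 = 0" "A (Suc n) = A n + of_int (cheb (Suc n)) / real (Suc n)" for n by (simp_all add: A_def)
  have "\<bar>A t - cheb_const\<bar> * (real t + 1) \<le> 5/8"
  \<comment> \<open>The general estimate (1 + 8/(t+2))/2 reaches 5/8 exactly at t = 30. Before that
    the partial sums are evaluated exactly; the worst one is t = 6.\<close>
  proof (cases "t < 30")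
    case True
    have A_num: "A (numeral k) = A (pred_numeral k) + of_int (cheb (numeral k)) / numeral k" for k
      using A(2)[of "pred_numeral k", folded numeral_eq_Suc] by simp
    have v1: "A (Suc 0) = 1" by (simp add: A_def cheb_def)
    have v5: "A 5 = 1" by (simp add: A_num v1 cheb_def)
    have v6: "A 6 = 5/6" using A(2)[of 5] v5 by (simp add: cheb_def)
    have v7: "A 7 = 41/42" using A(2)[of 6] v6 by (simp add: cheb_def)
    have v8: "A 8 = 41/42" using A(2)[of 7] v7 by (simp add: cheb_def)
    have v9: "A 9 = 41/42" using A(2)[of 8] v8 by (simp add: cheb_def)
    have v10: "A 10 = 92/105" using A(2)[of 9] v9 by (simp add: cheb_def)
    have v11: "A 11 = 1117/1155" using A(2)[of 10] v10 by (simp add: cheb_def)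
    have v12: "A 12 = 1361/1540" using A(2)[of 11] v11 by (simp add: cheb_def)
    have v13: "A 13 = 19233/20020" using A(2)[of 12] v12 by (simp add: cheb_def)
    have v14: "A 14 = 19233/20020" using A(2)[of 13] v13 by (simp add: cheb_def)
    have v15: "A 15 = 10739/12012" using A(2)[of 14] v14 by (simp add: cheb_def)
    have v16: "A 16 = 10739/12012" using A(2)[of 15] v15 by (simp add: cheb_def)
    have v17: "A 17 = 194575/204204" using A(2)[of 16] v16 by (simp add: cheb_def)
    have v18: "A 18 = 549691/612612" using A(2)[of 17] v17 by (simp add: cheb_def)
    have v19: "A 19 = 11056741/11639628" using A(2)[of 18] v18 by (simp add: cheb_def)
    have v20: "A 20 = 26186899/29099070" using A(2)[of 19] v19 by (simp add: cheb_def)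
    have v21: "A 21 = 26186899/29099070" using A(2)[of 20] v20 by (simp add: cheb_def)
    have v22: "A 22 = 26186899/29099070" using A(2)[of 21] v21 by (simp add: cheb_def)
    have v23: "A 23 = 631397747/669278610" using A(2)[of 22] v22 by (simp add: cheb_def)
    have v24: "A 24 = 2414044553/2677114440" using A(2)[of 23] v23 by (simp add: cheb_def)
    have v25: "A 25 = 2414044553/2677114440" using A(2)[of 24] v24 by (simp add: cheb_def)
    have v26: "A 26 = 2414044553/2677114440" using A(2)[of 25] v25 by (simp add: cheb_def)
    have v27: "A 27 = 2414044553/2677114440" using A(2)[of 26] v26 by (simp add: cheb_def)
    have v28: "A 28 = 2414044553/2677114440" using A(2)[of 27] v27 by (simp add: cheb_def)
    have v29: "A 29 = 72684406477/77636318760" using A(2)[of 28] v28 by (simp add: cheb_def)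
    note vals = v6 v7 v8 v9 v10 v11 v12 v13 v14 v15 v16 v17 v18 v19 v20 v21 v22 v23 v24 v25 v26 v27 v28 v29
    have "\<forall>t<30. t > 5 \<longrightarrow> \<bar>A t - cheb_const\<bar> * (real t + 1) \<le> 5/8"
      using cheb_const_bounds by (simp add: All_less_numeral vals abs_le_iff)
    then show ?thesis using True assms by blast
  next
    case False
    have "(1 + 8 / (real t + 2)) / 2 \<le> 5/8" using False by (simp add: field_simps)
    with L[of t] show ?thesis by (simp add: A_def L_eq)
  qed
  then show ?thesis by (simp add: A_def)
qed

text \<open>\<open>cheb\<close> vanishes at 2, 3, 4 and 5, so cutting at K = 5 leaves only N itself
  and \<open>N div 6\<close>, the latter with the small weight \<open>1 - cheb_const\<close>. The
  error 0.1198 is 5/8 * 1.15/6.\<close>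

lemma msum_one_recurrence:
  assumes psi: "\<And>n. psi n \<le> 115/100 * real n" and N: "N \<ge> 1000"
  shows "\<bar>msum (\<lambda>_. 1) N - (1 - cheb_const) * msum (\<lambda>_. 1) (N div 6) - (cheb_const * ln (real N) + cheb_const2)\<bar>
    \<le> 21/1000 + 11980/100000"
proof -
  let ?a = "\<lambda>m. of_int (cheb m) / real m"
  have e1: "(\<Sum>d\<in>{1..N}. mangoldt d * 1 / real d * (\<Sum>m\<in>{1..N div d}. ?a m))
     = ln_sum N - ln_sum (N div 2) / 2 - ln_sum (N div 3) / 3 - ln_sum (N div 5) / 5 + ln_sum (N div 30) / 30"
    using sum_mangoldt_cheb[of "\<lambda>m. 1 / real m" N] by (simp add: ln_sum_def)
  have "{1..5} = {1, 2, 3, 4, 5 :: nat}" by auto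
  then have e2: "(\<Sum>m\<in>{1..5}. ?a m * msum (\<lambda>_. 1) (N div m)) = msum (\<lambda>_. 1) N" "(\<Sum>m\<in>{1..5}. ?a m) = 1"
    by (simp_all add: cheb_def)
  have "psi (N div 6) \<le> 115/100 * (real N / 6)"
    using psi[of "N div 6"] div_real_bounds(1)[of 6 N] by simp
  then have e3: "5/8 * psi (N div 6) / real N \<le> 11980/100000"
    using N by (simp add: field_simps)
  have "\<bar>(\<Sum>d\<in>{1..N}. mangoldt d * 1 / real d * (\<Sum>m\<in>{1..N div d}. ?a m))
      - (\<Sum>m\<in>{1..5}. ?a m * msum (\<lambda>_. 1) (N div m)) - (cheb_const - (\<Sum>m\<in>{1..5}. ?a m)) * msum (\<lambda>_. 1) (N div Suc 5)\<bar>
      \<le> 5/8 * psi (N div Suc 5) / real N"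
    using N by (intro msum_hyperbola_approx cheb_tail) auto
  then have "\<bar>ln_sum N - ln_sum (N div 2) / 2 - ln_sum (N div 3) / 3 - ln_sum (N div 5) / 5 + ln_sum (N div 30) / 30
      - msum (\<lambda>_. 1) N + (1 - cheb_const) * msum (\<lambda>_. 1) (N div 6)\<bar> \<le> 5/8 * psi (N div 6) / real N"
    unfolding e1 e2 by (simp add: algebra_simps)
  with ln_sum_cheb[OF N] e3 show ?thesis unfolding abs_le_iff by linarith
qed

lemma cheb_const2_bounds: "-388/1000 \<le> cheb_const2" "cheb_const2 \<le> -387/1000"
proof -
  have sq: "l\<^sup>2 \<le> x\<^sup>2 \<and> x\<^sup>2 \<le> u\<^sup>2" if "0 \<le> l" "l \<le> x" "x \<le> u" for l x u :: real
    using that by (auto intro!: power_mono)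
  have "34011/10000 \<le> ln (30::real)" "ln (30::real) \<le> 34013/10000"
    using ln_2_bounds ln_3_bounds ln_5_bounds by (simp_all add: ln_30)
  from sq[OF _ this] sq[OF _ ln_2_bounds] sq[OF _ ln_3_bounds] sq[OF _ ln_5_bounds]
  show "-388/1000 \<le> cheb_const2" "cheb_const2 \<le> -387/1000"
    unfolding cheb_const2_def by (simp_all add: power2_eq_square)
qed

text \<open>
  The center \<open>-0.5737\<close> is the fixed point of the recurrence without its error term; it
  need not be, and is not exactly, the negative of the Euler--Mascheroni constant.
\<close>

lemma msum_one_bound:
  assumes psi: "\<And>n. psi n \<le> 115/100 * real n"
    and base: "\<And>n. 166 \<le> n \<Longrightarrow> n < 1000 \<Longrightarrow> \<bar>msum (\<lambda>_. 1) n - ln (real n) + 5737/10000\<bar> \<le> 1545/10000"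
    and n: "n \<ge> 166"
  shows "\<bar>msum (\<lambda>_. 1) n - ln (real n) + 5737/10000\<bar> \<le> 1545/10000"
  using n
proof (induction n rule: less_induct)
  case (less N)
  show ?case
  proof (cases "N < 1000")
    case False
    then have N: "N \<ge> 1000" by simp
    define M where "M = N div 6"
    define l where "l = ln (real N)"
    define m where "m = ln (real M)"
    define c where "c = 1 - cheb_const"
    have M: "166 \<le> M" "M < N" using N by (auto simp: M_def)
    have IH: "\<bar>msum (\<lambda>_. 1) M - m + 5737/10000\<bar> \<le> 1545/10000"
      using less.IH[of M] M by (simp add: m_def)
    have y: "real M \<le> real N / 6" "real N / 6 < real M + 1" using div_real_bounds[of 6 N] by (auto simp: M_def)
    have l6: "ln (real N / 6) = l - ln 6" using N by (simp add: l_def ln_div)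
    have "m \<le> ln (real N / 6)" unfolding m_def using y M by (intro ln_mono) auto
    then have 1: "m \<le> l - ln 6" using l6 by simp
    have "ln (real N / 6) - m = ln (real N / 6 / real M)" unfolding m_def using M N by (subst ln_div) auto
    also have "\<dots> \<le> real N / 6 / real M - 1" using M N by (intro ln_le_minus_one) auto
    \<comment> \<open>N/6 exceeds M by less than 1 and M >= 166, so rounding down shifts the
      logarithm by at most 1/166.\<close>
    also have "\<dots> \<le> 1/166" using y M by (simp add: field_simps)
    finally have 2: "l - ln 6 - 1/166 \<le> m" using l6 by simp
    define w where "w = msum (\<lambda>_. 1) M - l"
    have ln6: "ln (6::real) = ln 2 + ln 3" using ln_mult[of 2 "3::real"] by simp
    have w: "w \<le> - ln 6 - 5737/10000 + 1545/10000" "w \<ge> - ln 6 - 1/166 - 5737/10000 - 1545/10000"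
      using 1 2 IH unfolding w_def abs_le_iff by linarith+
    have c: "786/10000 \<le> c" "c \<le> 7873/100000" using cheb_const_bounds by (auto simp: c_def)
    have "c * w \<le> c * (- ln 6 - 4192/10000)" using w c by (intro mult_left_mono) auto
    also have "\<dots> \<le> 786/10000 * (- ln 6 - 4192/10000)"
      using c ln_2_bounds ln_3_bounds by (intro mult_right_mono_neg) (auto simp: ln6)
    finally have cw1: "c * w \<le> 786/10000 * (- ln 6 - 4192/10000)" .
    have "c * w \<ge> c * (- ln 6 - 1/166 - 7282/10000)" using w c by (intro mult_left_mono) auto
    moreover have "c * (- ln 6 - 1/166 - 7282/10000) \<ge> 7873/100000 * (- ln 6 - 1/166 - 7282/10000)"
      using c ln_2_bounds ln_3_bounds by (intro mult_right_mono_neg) (auto simp: ln6)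
    ultimately have cw2: "c * w \<ge> 7873/100000 * (- ln 6 - 1/166 - 7282/10000)" by linarith
    have "\<bar>msum (\<lambda>_. 1) N - l - c * w - cheb_const2\<bar> \<le> 21/1000 + 11980/100000"
      using msum_one_recurrence[OF psi N] by (simp add: c_def w_def l_def M_def algebra_simps)
    moreover define z where "z = c * w"
    ultimately show ?thesis using cw1 cw2 cheb_const2_bounds ln_2_bounds ln_3_bounds
      unfolding l_def[symmetric] ln6 abs_le_iff z_def[symmetric] by argo
  qed (use base less.prems in auto)
qed

section \<open>Two character sums\<close>

text \<open>
  The nontrivial characters modulo 4 and modulo 3, made to vanish at multiples of 3 and of 2,
  respectively. Removing that Euler factor pushes the second term of the series of
  \<open>chi n / n\<close> out to \<open>n = 5\<close>, which makes the contraction below effective.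
\<close>

definition chi12 :: "nat \<Rightarrow> int" where
  "chi12 n = (if n mod 12 \<in> {1, 5} then 1 else if n mod 12 \<in> {7, 11} then -1 else 0)"

definition chi6 :: "nat \<Rightarrow> int" where
  "chi6 n = (if n mod 6 = 1 then 1 else if n mod 6 = 5 then -1 else 0)"

lemma chi12_mod: "chi12 (n mod 12) = chi12 n" by (simp add: chi12_def)
lemma chi6_mod: "chi6 (n mod 6) = chi6 n" by (simp add: chi6_def)

lemma less_12_cases: "x < 12 \<Longrightarrow> x \<in> {0,1,2,3,4,5,6,7,8,9,10,11 :: nat}"
  by (simp, presburger)

lemma less_6_cases: "x < 6 \<Longrightarrow> x \<in> {0,1,2,3,4,5 :: nat}"
  by (simp, presburger)

lemma chi12_mult: "chi12 (m * n) = chi12 m * chi12 n"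
proof -
  have small: "\<forall>a\<in>{0,1,2,3,4,5,6,7,8,9,10,11}. \<forall>b\<in>{0,1,2,3,4,5,6,7,8,9,10,11}. chi12 (a * b) = chi12 a * chi12 b"
    unfolding ball_simps chi12_def by simp
  have prod0: "chi12 (m * n) = chi12 ((m mod 12) * (n mod 12))"
    by (metis chi12_mod mod_mult_eq)
  have "m mod 12 \<in> {0,1,2,3,4,5,6,7,8,9,10,11}" "n mod 12 \<in> {0,1,2,3,4,5,6,7,8,9,10,11}"
    by (rule less_12_cases; simp)+
  from bspec[OF bspec[OF small this(1)] this(2)] have "chi12 ((m mod 12) * (n mod 12)) = chi12 (m mod 12) * chi12 (n mod 12)" .
  with prod0 show ?thesis by (simp add: chi12_mod)
qed

lemma chi6_mult: "chi6 (m * n) = chi6 m * chi6 n"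
proof -
  have small: "\<forall>a\<in>{0,1,2,3,4,5}. \<forall>b\<in>{0,1,2,3,4,5}. chi6 (a * b) = chi6 a * chi6 b"
    unfolding ball_simps chi6_def by simp
  have prod0: "chi6 (m * n) = chi6 ((m mod 6) * (n mod 6))"
    by (metis chi6_mod mod_mult_eq)
  have "m mod 6 \<in> {0,1,2,3,4,5}" "n mod 6 \<in> {0,1,2,3,4,5}"
    by (rule less_6_cases; simp)+
  from bspec[OF bspec[OF small this(1)] this(2)] have "chi6 ((m mod 6) * (n mod 6)) = chi6 (m mod 6) * chi6 (n mod 6)" .
  with prod0 show ?thesis by (simp add: chi6_mod)
qed

lemma psum_chi12_bounds:
  "psum chi12 t = psum chi12 (t mod 12)" "psum chi12 t \<in> {0..2}" "psum (\<lambda>m. 1 * psum chi12 m - 1) t \<in> {0..2}"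
proof -
  have small: "\<forall>t<12. psum chi12 t \<in> {0..2} \<and> psum (\<lambda>m. 1 * psum chi12 m - 1) t \<in> {0..2}"
    "psum chi12 12 = 0" "psum (\<lambda>m. 1 * psum chi12 m - 1) 12 = 0"
    by (simp_all add: All_less_numeral chi12_def psum_numeral)
  have per: "chi12 (m + 12) = chi12 m" for m by (simp add: chi12_def)
  note * = psum_periodic_bounds[of 12 chi12, OF _ per small(2,3,1)]
  show "psum chi12 t = psum chi12 (t mod 12)" "psum chi12 t \<in> {0..2}" "psum (\<lambda>m. 1 * psum chi12 m - 1) t \<in> {0..2}"
    by (rule *; simp)+
qed

lemma psum_chi6_bounds:
  "psum chi6 t = psum chi6 (t mod 6)" "psum chi6 t \<in> {0..1}" "psum (\<lambda>m. 3 * psum chi6 m - 2) t \<in> {0..4}"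
proof -
  have small: "\<forall>t<6. psum chi6 t \<in> {0..1} \<and> psum (\<lambda>m. 3 * psum chi6 m - 2) t \<in> {0..4}"
    "psum chi6 6 = 0" "psum (\<lambda>m. 3 * psum chi6 m - 2) 6 = 0"
    by (simp_all add: All_less_numeral chi6_def psum_numeral)
  have per: "chi6 (m + 6) = chi6 m" for m by (simp add: chi6_def)
  note * = psum_periodic_bounds[of 6 chi6, OF _ per small(2,3,1)]
  show "psum chi6 t = psum chi6 (t mod 6)" "psum chi6 t \<in> {0..1}" "psum (\<lambda>m. 3 * psum chi6 m - 2) t \<in> {0..4}"
    by (rule *; simp)+
qed

definition chi_ln_sum :: "(nat \<Rightarrow> int) \<Rightarrow> nat \<Rightarrow> real" where
  "chi_ln_sum a n = (\<Sum>k\<in>{1..n}. of_int (a k) * ln (real k) / real k)"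

text \<open>Summation by parts with the partial sums counted from M. The condition M >= 2 puts every
  index of the tail at 3 or above, where ln k / k decreases.\<close>

lemma chi_ln_sum_diff:
  assumes M: "M \<ge> 2" "M \<le> n" and w: "\<And>k. \<bar>psum a k - psum a M\<bar> \<le> w"
  shows "\<bar>chi_ln_sum a n - chi_ln_sum a M\<bar> \<le> of_int w * (ln (real (Suc M)) / real (Suc M))"
proof -
  define g where "g k = ln (real k) / real k" for k
  define S where "S k = real_of_int (psum a k - psum a M)" for k
  have S: "\<bar>S k\<bar> \<le> of_int w" for k
    using w[of k] unfolding S_def by (metis of_int_abs of_int_le_iff)
  have g_dec: "g (Suc k) \<le> g k" if "M < k" for k
  proof -
    have "3 \<le> real k" using that M by simp
    then have "exp 1 \<le> real k" using exp_le by linarith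
    then show ?thesis unfolding g_def by (intro ln_x_over_x_mono) auto
  qed
  have g_nn: "g k \<ge> 0" if "M < k" for k using that by (simp add: g_def)
  have "\<bar>chi_ln_sum a n - chi_ln_sum a M - S n * g (Suc n)\<bar> \<le> of_int w * (g (Suc M) - g (Suc n))"
    using M(2)
  proof (induction n rule: dec_induct)
    case (step n)
    have "chi_ln_sum a (Suc n) = chi_ln_sum a n + (S (Suc n) - S n) * g (Suc n)"
      by (simp add: chi_ln_sum_def S_def g_def psum_Suc)
    then have "chi_ln_sum a (Suc n) - chi_ln_sum a M - S (Suc n) * g (Suc (Suc n))
      = (chi_ln_sum a n - chi_ln_sum a M - S n * g (Suc n)) + S (Suc n) * (g (Suc n) - g (Suc (Suc n)))"
      by (simp add: algebra_simps)
    moreover have "\<bar>S (Suc n) * (g (Suc n) - g (Suc (Suc n)))\<bar> \<le> of_int w * (g (Suc n) - g (Suc (Suc n)))"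
      using S[of "Suc n"] g_dec[of "Suc n"] step by (simp add: abs_mult mult_right_mono)
    ultimately show ?case using step.IH by (simp add: algebra_simps)
  qed (simp add: S_def)
  moreover have "\<bar>S n * g (Suc n)\<bar> \<le> of_int w * g (Suc n)"
    using S[of n] g_nn[of "Suc n"] M by (simp add: abs_mult mult_right_mono)
  ultimately show ?thesis unfolding g_def[symmetric] by (simp add: algebra_simps)
qed

lemma ln_1001: "ln (1001::real) / 1001 \<le> 7/1000"
  using ln_le_1000[of 1001] by simp

lemma chi12_ln_sum_diff:
  assumes "N \<ge> 1000" shows "\<bar>chi_ln_sum chi12 N - chi_ln_sum chi12 1000\<bar> \<le> 7/1000"
proof -
  \<comment> \<open>At 1000 the partial sum is in the middle of its range 0..2, so the oscillation
    from there is 1 and not 2.\<close>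
  have "psum chi12 1000 = 1" by (subst psum_chi12_bounds(1)) (simp add: psum_numeral chi12_def)
  then have "\<bar>psum chi12 k - psum chi12 1000\<bar> \<le> 1" for k using psum_chi12_bounds(2)[of k] by auto
  from chi_ln_sum_diff[of 1000 N chi12, OF _ assms this] show ?thesis using ln_1001 by simp
qed

lemma chi6_ln_sum_diff:
  assumes "N \<ge> 1000" shows "\<bar>chi_ln_sum chi6 N - chi_ln_sum chi6 1000\<bar> \<le> 7/1000"
proof -
  have "psum chi6 1000 = 1" by (subst psum_chi6_bounds(1)) (simp add: psum_numeral chi6_def)
  then have "\<bar>psum chi6 k - psum chi6 1000\<bar> \<le> 1" for k using psum_chi6_bounds(2)[of k] by auto
  from chi_ln_sum_diff[of 1000 N chi6, OF _ assms this] show ?thesis using ln_1001 by simp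
qed

text \<open>A finite form of -L' = (-L'/L) L at s = 1: with the kernel chi(m)/m the hyperbola sum is
  exactly \<open>chi_ln_sum\<close>, and the bound for \<open>psi\<close> turns the tail into an
  absolute error.\<close>

lemma character_recurrence:
  fixes chi :: "nat \<Rightarrow> int"
  assumes mult: "\<And>m n. chi (m * n) = chi m * chi n" and chi: "\<And>n. \<bar>chi n\<bar> \<le> 1"
    and tail: "\<And>t. t > K \<Longrightarrow> \<bar>(\<Sum>m\<in>{1..t}. of_int (chi m) / real m) - L\<bar> * (real t + 1) \<le> c"
    and psi: "\<And>n. psi n \<le> 115/100 * real n" and N: "N > 0" and c: "c \<ge> 0"
  shows "\<bar>chi_ln_sum chi N - (\<Sum>m\<in>{1..K}. of_int (chi m) / real m * msum (\<lambda>n. of_int (chi n)) (N div m))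
     - (L - (\<Sum>m\<in>{1..K}. of_int (chi m) / real m)) * msum (\<lambda>n. of_int (chi n)) (N div Suc K)\<bar>
    \<le> c * (115/100) / real (Suc K)"
proof -
  define f where "f n = real_of_int (chi n)" for n
  have "(\<Sum>d\<in>{1..N}. mangoldt d * (f d / real d) * (\<Sum>m\<in>{1..N div d}. f m / real m)) = chi_ln_sum chi N"
    using sum_mangoldt_mult[of "\<lambda>n. f n / real n" N] by (simp add: f_def mult chi_ln_sum_def)
  moreover have "\<bar>(\<Sum>d\<in>{1..N}. mangoldt d * f d / real d * (\<Sum>m\<in>{1..N div d}. f m / real m))
       - (\<Sum>m\<in>{1..K}. f m / real m * msum f (N div m)) - (L - (\<Sum>m\<in>{1..K}. f m / real m)) * msum f (N div Suc K)\<bar>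
     \<le> c * psi (N div Suc K) / real N"
  proof (rule msum_hyperbola_approx[OF _ _ N])
    show "\<bar>f d\<bar> \<le> 1" for d using chi[of d] by (simp add: f_def flip: of_int_abs)
  qed (use tail in \<open>simp add: f_def\<close>)
  moreover have "c * psi (N div Suc K) / real N \<le> c * (115/100) / real (Suc K)"
  proof -
    have "psi (N div Suc K) \<le> 115/100 * (real N / real (Suc K))"
      by (rule order.trans[OF psi mult_left_mono[OF div_real_bounds(1)]]) auto
    then have "c * psi (N div Suc K) / real N \<le> c * (115/100 * (real N / real (Suc K))) / real N"
      using c by (intro divide_right_mono mult_left_mono) auto
    then show ?thesis using N by simp
  qed
  ultimately show ?thesis by (simp add: f_def[abs_def])
qed

lemma atLeast1_atMost_numerals:
  "{1..4} = {1,2,3,4 :: nat}" "{1..10} = {1,2,3,4,5,6,7,8,9,10 :: nat}" "{1..12} = {1,2,3,4,5,6,7,8,9,10,11,12 :: nat}"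
  by (auto, presburger+)

text \<open>Here L is pi/3, that is pi/4 times the removed Euler factor 1 + 1/3. At t = 12, the end
  of a period, both iterated sums vanish, and the one-sided bounds give L to within about 0.01. The
  tail constant is 1 + 2/13.\<close>

lemma chi12_limit:
  obtains L where "10431/10000 \<le> L" "L \<le> 10542/10000"
    "\<And>t. t > 10 \<Longrightarrow> \<bar>(\<Sum>m\<in>{1..t}. of_int (chi12 m) / real m) - L\<bar> * (real t + 1) \<le> 15/13"
proof -
  let ?A = "\<lambda>t. \<Sum>m\<in>{1..t}. of_int (chi12 m) / real m"
  obtain L where
    tail: "\<And>t. \<bar>?A t - L\<bar> * (real t + 1) \<le> (max (of_int (1 * 2 - 1)) (of_int (1 - 1 * 0)) + of_int (2 - 0) / (real t + 2)) / of_int 1" and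
    lo: "\<And>t. ?A t - L \<ge> of_int (1 * psum chi12 t - 1) / (of_int 1 * (real t + 1)) + of_int (psum (\<lambda>m. 1 * psum chi12 m - 1) t - 2) / (of_int 1 * (real t + 1) * (real t + 2))" and
    hi: "\<And>t. ?A t - L \<le> of_int (1 * psum chi12 t - 1) / (of_int 1 * (real t + 1)) + of_int (psum (\<lambda>m. 1 * psum chi12 m - 1) t - 0) / (of_int 1 * (real t + 1) * (real t + 2))"
    by (rule periodic_tail[OF zero_less_one psum_chi12_bounds(3,2)]) (rule that; assumption)
  have A: "?A 12 = 372/385" unfolding atLeast1_atMost_numerals by (simp add: chi12_def)
  have p: "psum chi12 12 = 0" "psum (\<lambda>m. 1 * psum chi12 m - 1) 12 = 0"
    by (simp_all add: psum_numeral chi12_def)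
  show ?thesis
  proof (rule that)
    show "10431/10000 \<le> L" using hi[of 12] unfolding A p by simp
    show "L \<le> 10542/10000" using lo[of 12] unfolding A p by simp
    fix t :: nat assume "t > 10"
    then have "2 / (real t + 2) \<le> 2/13" by (intro divide_left_mono) auto
    with tail[of t] show "\<bar>?A t - L\<bar> * (real t + 1) \<le> 15/13" by simp
  qed
qed

text \<open>Here L is pi/(2 sqrt 3), again read off at t = 12, where two periods end. The tail
  constant is (2 + 4/7)/3.\<close>

lemma chi6_limit:
  obtains L where "9032/10000 \<le> L" "L \<le> 9106/10000"
    "\<And>t. t > 4 \<Longrightarrow> \<bar>(\<Sum>m\<in>{1..t}. of_int (chi6 m) / real m) - L\<bar> * (real t + 1) \<le> 6/7"
proof -
  let ?A = "\<lambda>t. \<Sum>m\<in>{1..t}. of_int (chi6 m) / real m"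
  obtain L where
    tail: "\<And>t. \<bar>?A t - L\<bar> * (real t + 1) \<le> (max (of_int (3 * 1 - 2)) (of_int (2 - 3 * 0)) + of_int (4 - 0) / (real t + 2)) / of_int 3" and
    lo: "\<And>t. ?A t - L \<ge> of_int (3 * psum chi6 t - 2) / (of_int 3 * (real t + 1)) + of_int (psum (\<lambda>m. 3 * psum chi6 m - 2) t - 4) / (of_int 3 * (real t + 1) * (real t + 2))" and
    hi: "\<And>t. ?A t - L \<le> of_int (3 * psum chi6 t - 2) / (of_int 3 * (real t + 1)) + of_int (psum (\<lambda>m. 3 * psum chi6 m - 2) t - 0) / (of_int 3 * (real t + 1) * (real t + 2))"
    by (rule periodic_tail[OF zero_less_numeral psum_chi6_bounds(3,2)]) (rule that; assumption)
  have A: "?A 12 = 328/385" unfolding atLeast1_atMost_numerals by (simp add: chi6_def)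
  have p: "psum chi6 12 = 0" "psum (\<lambda>m. 3 * psum chi6 m - 2) 12 = 0"
    by (simp_all add: psum_numeral chi6_def)
  show ?thesis
  proof (rule that)
    show "9032/10000 \<le> L" using hi[of 12] unfolding A p by simp
    show "L \<le> 9106/10000" using lo[of 12] unfolding A p by simp
    fix t :: nat assume "t > 4"
    then have "4 / (real t + 2) \<le> 4/7" by (intro divide_left_mono) auto
    with tail[of t] show "\<bar>?A t - L\<bar> * (real t + 1) \<le> 6/7" by simp
  qed
qed

lemma abs_mult_bound:
  fixes x y :: real
  assumes "\<bar>x\<bar> \<le> a" "\<bar>y\<bar> \<le> b"
  shows "x * y \<le> a * b" "- (a * b) \<le> x * y"
proof -
  have "\<bar>x * y\<bar> \<le> a * b" unfolding abs_mult using assms by (intro mult_mono) auto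
  then show "x * y \<le> a * b" "- (a * b) \<le> x * y" by (auto simp: abs_le_iff)
qed

abbreviation "chi_msum chi \<equiv> msum (\<lambda>n. of_int (chi n))"

text \<open>The centre 0.029 is the fixed point \<open>chi_ln_sum chi12 1000\<close> / L. Cutting at
  K = 10 gives weights 1/5, 1/7 and about 0.01 and an error of 0.121; the same tail estimate with K
  = 4 would leave an error near 0.3, larger than the whole radius.\<close>

lemma msum_chi12_bound:
  assumes psi: "\<And>n. psi n \<le> 115/100 * real n"
    and base: "\<And>n. 90 \<le> n \<Longrightarrow> n < 1000 \<Longrightarrow> \<bar>chi_msum chi12 n - 29/1000\<bar> \<le> 205/1000"
    and chi_ln_sum: "\<bar>chi_ln_sum chi12 1000 - 304/10000\<bar> \<le> 1/1000"
    and n: "n \<ge> 90"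
  shows "\<bar>chi_msum chi12 n - 29/1000\<bar> \<le> 205/1000"
proof -
  obtain L where L: "10431/10000 \<le> L" "L \<le> 10542/10000"
    and tail: "\<And>t. t > 10 \<Longrightarrow> \<bar>(\<Sum>m\<in>{1..t}. of_int (chi12 m) / real m) - L\<bar> * (real t + 1) \<le> 15/13"
    using chi12_limit by blast
  show ?thesis
    using n
  proof (induction n rule: less_induct)
    case (less N)
    show ?case
    proof (cases "N < 1000")
      case False
      then have N: "N \<ge> 1000" by simp
      define X where "X n = chi_msum chi12 n" for n
      define u where "u j = X (N div j) - 29/1000" for j
      have u: "\<bar>u j\<bar> \<le> 205/1000" if "j \<in> {5, 7, 11}" for j
      proof -
        have "90 \<le> N div j" "N div j < N" using that N by (auto simp: less_eq_div_iff_mult_less_eq)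
        then show ?thesis using less.IH[of "N div j"] by (simp add: u_def X_def)
      qed
      have r0: "\<bar>chi_ln_sum chi12 N - (\<Sum>m\<in>{1..10}. of_int (chi12 m) / real m * X (N div m))
         - (L - (\<Sum>m\<in>{1..10}. of_int (chi12 m) / real m)) * X (N div Suc 10)\<bar> \<le> 15/13 * (115/100) / real (Suc 10)"
        unfolding X_def using N
        by (intro character_recurrence[OF chi12_mult _ tail psi]) (auto simp: chi12_def)
      have sums: "(\<Sum>m\<in>{1..10}. of_int (chi12 m) / real m * X (N div m)) = X N + X (N div 5) / 5 - X (N div 7) / 7"
        "(\<Sum>m\<in>{1..10}. of_int (chi12 m) / real m) = (37/35 :: real)"
        unfolding atLeast1_atMost_numerals by (simp_all add: chi12_def)
      have rec: "\<bar>chi_ln_sum chi12 N - (X N + X (N div 5) / 5 - X (N div 7) / 7) - (L - 37/35) * X (N div 11)\<bar> \<le> 12064/100000"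
        using r0 unfolding sums by simp
      have "(L - 37/35) * X (N div 11) = (L - 37/35) * u 11 + (L - 37/35) * (29/1000)"
        by (simp add: u_def algebra_simps)
      moreover have "\<bar>L - 37/35\<bar> \<le> 141/10000" using L by (simp add: abs_le_iff)
      then have "(L - 37/35) * u 11 \<le> 141/10000 * (205/1000)" "- (141/10000 * (205/1000)) \<le> (L - 37/35) * u 11"
        by (rule abs_mult_bound; use u in simp)+
      moreover define z where "z = (L - 37/35) * u 11"
      moreover note u[of 5, simplified] u[of 7, simplified]
      ultimately show ?thesis
        using rec chi_ln_sum chi12_ln_sum_diff[OF N] L
        unfolding X_def[symmetric] abs_le_iff u_def[of 5] u_def[of 7] by argo
    qed (use base less.prems in auto)
  qed
qed

text \<open>Since \<open>chi6\<close> vanishes at 2, 3 and 4, cutting at K = 4 leaves a single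
  weight L - 1 of size below 0.1. The centre lies near the fixed point
  \<open>chi_ln_sum chi6 1000\<close> / L, and the radius absorbs the difference.\<close>

lemma msum_chi6_bound:
  assumes psi: "\<And>n. psi n \<le> 115/100 * real n"
    and base: "\<And>n. 200 \<le> n \<Longrightarrow> n < 1000 \<Longrightarrow> \<bar>chi_msum chi6 n + 1373/10000\<bar> \<le> 232/1000"
    and chi_ln_sum: "\<bar>chi_ln_sum chi6 1000 + 1222/10000\<bar> \<le> 1/1000"
    and n: "n \<ge> 200"
  shows "\<bar>chi_msum chi6 n + 1373/10000\<bar> \<le> 232/1000"
proof -
  obtain L where L: "9032/10000 \<le> L" "L \<le> 9106/10000"
    and tail: "\<And>t. t > 4 \<Longrightarrow> \<bar>(\<Sum>m\<in>{1..t}. of_int (chi6 m) / real m) - L\<bar> * (real t + 1) \<le> 6/7"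
    using chi6_limit by blast
  show ?thesis
    using n
  proof (induction n rule: less_induct)
    case (less N)
    show ?case
    proof (cases "N < 1000")
      case False
      then have N: "N \<ge> 1000" by simp
      define X where "X n = chi_msum chi6 n" for n
      define u where "u = X (N div 5) + 1373/10000"
      have "200 \<le> N div 5" "N div 5 < N" using N by (auto simp: less_eq_div_iff_mult_less_eq)
      then have u: "\<bar>u\<bar> \<le> 232/1000" using less.IH[of "N div 5"] by (simp add: u_def X_def)
      have r0: "\<bar>chi_ln_sum chi6 N - (\<Sum>m\<in>{1..4}. of_int (chi6 m) / real m * X (N div m))
         - (L - (\<Sum>m\<in>{1..4}. of_int (chi6 m) / real m)) * X (N div Suc 4)\<bar> \<le> 6/7 * (115/100) / real (Suc 4)"
        unfolding X_def using N
        by (intro character_recurrence[OF chi6_mult _ tail psi]) (auto simp: chi6_def)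
      have sums: "(\<Sum>m\<in>{1..4}. of_int (chi6 m) / real m * X (N div m)) = X N"
        "(\<Sum>m\<in>{1..4}. of_int (chi6 m) / real m) = (1 :: real)"
        unfolding atLeast1_atMost_numerals by (simp_all add: chi6_def)
      have rec: "\<bar>chi_ln_sum chi6 N - X N - (L - 1) * X (N div 5)\<bar> \<le> 19715/100000"
        using r0 unfolding sums by simp
      have "(L - 1) * X (N div 5) = (L - 1) * u - (L - 1) * (1373/10000)"
        by (simp add: u_def algebra_simps)
      moreover have "\<bar>L - 1\<bar> \<le> 968/10000" using L by (simp add: abs_le_iff)
      note abs_mult_bound[OF this u]
      moreover define z where "z = (L - 1) * u"
      ultimately show ?thesis
        using rec chi_ln_sum chi6_ln_sum_diff[OF N] L
        unfolding X_def[symmetric] abs_le_iff by argo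
    qed (use base less.prems in auto)
  qed
qed

section \<open>Residue classes in terms of characters\<close>

text \<open>The prime below a prime power is unique, which identifies the \<open>THE\<close> in the
  definition with \<open>aprimedivisor\<close>.\<close>

lemma Lambda_g_eq: "Lambda_g d a n = (if [int (aprimedivisor n) = a] (mod d) then mangoldt n else 0)"
proof (cases "primepow n")
  case True
  define p where "p = aprimedivisor n"
  obtain q k where q: "prime q" "k > 0" "n = q ^ k" using True by (auto simp: primepow_def)
  have uniq: "p' = p" if "prime p'" "r \<ge> 1" "n = p' ^ r" for p' r
    using that by (simp add: p_def aprimedivisor_prime_power)
  have p: "prime p" "n = p ^ k" using q uniq[of q k] by auto
  have "(THE p. prime p \<and> (\<exists>r\<ge>1. n = p ^ r)) = p"
    using p q(2) uniq by (intro the_equality) (auto simp: Suc_le_eq)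
  moreover have "(\<exists>p r. prime p \<and> r \<ge> 1 \<and> n = p ^ r \<and> [int p = a] (mod d)) \<longleftrightarrow> [int p = a] (mod d)"
    using p q(2) uniq by (metis One_nat_def Suc_le_eq)
  ultimately show ?thesis using True by (simp add: Lambda_g_def mangoldt_def p_def)
next
  case False
  then have "\<not> (\<exists>p r. prime p \<and> r \<ge> 1 \<and> n = p ^ r \<and> [int p = a] (mod d))"
    by (auto simp: Suc_le_eq)
  then show ?thesis using False by (simp only: Lambda_g_def mangoldt_def if_False if_cancel)
qed

definition H_nat :: "int \<Rightarrow> int \<Rightarrow> nat \<Rightarrow> real" where
  "H_nat d a n = (\<Sum>m\<in>{1..n}. Lambda_g d a m / real m)"

definition p_part :: "nat \<Rightarrow> nat \<Rightarrow> real" where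
  "p_part p n = (\<Sum>m\<in>{1..n}. (if aprimedivisor m = p then mangoldt m else 0) / real m)"

definition neg_mangoldt :: "(nat \<Rightarrow> int) \<Rightarrow> nat \<Rightarrow> real" where
  "neg_mangoldt chi m = (if chi (aprimedivisor m) = -1 then mangoldt m else 0)"

text \<open>The obstacle to a plain character decomposition: \<open>Lambda_g\<close> sorts p^r by
  the class of p, whereas chi sees the class of p^r. The two disagree exactly at even powers of
  primes with chi p = -1.\<close>

definition even_part :: "(nat \<Rightarrow> int) \<Rightarrow> nat \<Rightarrow> real" where
  "even_part chi n = (\<Sum>m\<in>{1..n}. (if chi m = 1 then neg_mangoldt chi m else 0) / real m)"

lemma chi_power:
  fixes chi :: "nat \<Rightarrow> int"
  assumes "\<And>m n. chi (m * n) = chi m * chi n" "chi 1 = 1"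
  shows "chi (p ^ k) = chi p ^ k"
  using assms(2) by (induction k) (simp_all add: assms(1))

lemma prime_mod_12:
  assumes "prime (p::nat)" "p \<noteq> 2" "p \<noteq> 3"
  shows "p mod 12 \<in> {1, 5, 7, 11}"
proof -
  have "\<not> 2 dvd p" "\<not> 3 dvd p"
    using assms by (auto dest: primes_dvd_imp_eq[rotated 2])
  moreover have "2 dvd p \<longleftrightarrow> 2 dvd p mod 12" "3 dvd p \<longleftrightarrow> 3 dvd p mod 12" by (simp_all add: dvd_mod_iff)
  moreover have "p mod 12 \<in> {0,1,2,3,4,5,6,7,8,9,10,11}" by (rule less_12_cases) simp
  ultimately show ?thesis by auto
qed

text \<open>At an odd power chi m = chi p, so (1 + chi m)/2 and (1 - chi m)/2 select the right
  primes; at an even power of a prime with chi p = -1 they select the wrong one, which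
  \<open>E\<close> corrects. At powers of 2 and 3, where chi is 0, the stray
  \<open>mangoldt m\<close> is subtracted.\<close>

lemma split_coprime_6:
  fixes chi :: "nat \<Rightarrow> int"
  assumes mult: "\<And>m n. chi (m * n) = chi m * chi n" "chi 1 = 1" and "chi 2 = 0" "chi 3 = 0"
    and neq: "\<forall>p. prime p \<longrightarrow> p \<noteq> 2 \<longrightarrow> p \<noteq> 3 \<longrightarrow> chi p \<in> {1, -1}"
  defines "q \<equiv> \<lambda>p m. if aprimedivisor m = p then mangoldt m else (0::real)"
    and "E \<equiv> \<lambda>m. if chi m = 1 then neg_mangoldt chi m else 0"
  shows "2 * (if aprimedivisor m \<notin> {2, 3} \<and> chi (aprimedivisor m) = 1 then mangoldt m else 0)
     = mangoldt m + of_int (chi m) * mangoldt m - q 2 m - q 3 m - 2 * E m" (is ?th1)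
   and "2 * (if aprimedivisor m \<notin> {2, 3} \<and> chi (aprimedivisor m) = -1 then mangoldt m else 0)
     = mangoldt m - of_int (chi m) * mangoldt m - q 2 m - q 3 m + 2 * E m" (is ?th2)
proof -
  have "?th1 \<and> ?th2"
  proof (cases "primepow m")
    case True
    then obtain p k where p: "prime p" "k > 0" "m = p ^ k" by (auto simp: primepow_def)
    have ap: "aprimedivisor m = p" using p by (simp add: aprimedivisor_prime_power)
    have mg: "mangoldt m = ln (real p)" using p by simp
    have chi: "chi m = chi p ^ k" using p mult by (simp add: chi_power)
    consider "p = 2" | "p = 3" | "p \<notin> {2,3}" "chi p = 1" | "p \<notin> {2,3}" "chi p = -1" "even k" | "p \<notin> {2,3}" "chi p = -1" "odd k"
      using neq p(1) by auto
    then show ?thesis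
      by cases (use assms(3,4) p(2) in \<open>simp_all add: q_def E_def neg_mangoldt_def ap chi mg power_0_left\<close>)
  qed (simp add: q_def E_def neg_mangoldt_def mangoldt_def)
  then show ?th1 ?th2 by auto
qed

lemma chi12_prime: "\<forall>p. prime p \<longrightarrow> p \<noteq> 2 \<longrightarrow> p \<noteq> 3 \<longrightarrow> chi12 p \<in> {1, -1}"
proof (intro allI impI)
  fix p :: nat assume p: "prime p" "p \<noteq> 2" "p \<noteq> 3"
  show "chi12 p \<in> {1, -1}" using prime_mod_12[OF p] by (auto simp: chi12_def)
qed

lemma chi6_prime: "\<forall>p. prime p \<longrightarrow> p \<noteq> 2 \<longrightarrow> p \<noteq> 3 \<longrightarrow> chi6 p \<in> {1, -1}"
proof (intro allI impI)
  fix p :: nat assume p: "prime p" "p \<noteq> 2" "p \<noteq> 3"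
  have "p mod 6 = (p mod 12) mod 6" by (simp add: mod_mod_cancel)
  then have "p mod 6 = 1 \<or> p mod 6 = 5" using prime_mod_12[OF p] by auto
  then show "chi6 p \<in> {1, -1}" by (auto simp: chi6_def)
qed

lemma aprimedivisor_cases:
  assumes "(m::nat) > 1"
  obtains "aprimedivisor m = 2" | "aprimedivisor m = 3"
    | r where "aprimedivisor m mod 12 = r" "r \<in> {1, 5, 7, 11}" "aprimedivisor m \<noteq> 2" "aprimedivisor m \<noteq> 3"
  using prime_mod_12[of "aprimedivisor m"] aprimedivisor_nat(1)[of m] assms by fastforce

lemma mod_12_cases:
  fixes p r :: nat
  assumes "p mod 12 = r"
  shows "p mod 3 = r mod 3 \<and> p mod 4 = r mod 4 \<and> p mod 6 = r mod 6"
  unfolding assms[symmetric] by (simp add: mod_mod_cancel)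

lemma cong_nat_int: "[int p = int a] (mod int d) \<longleftrightarrow> p mod d = a mod d"
  unfolding cong_def by (metis of_nat_eq_iff zmod_int)

text \<open>The prime 3 belongs to the class 3 mod 4 but is invisible to \<open>chi12\<close>, hence
  the extra summand.\<close>

lemma Lambda_g_4:
  "Lambda_g 4 1 m = (if aprimedivisor m \<notin> {2, 3} \<and> chi12 (aprimedivisor m) = 1 then mangoldt m else 0)"
  "Lambda_g 4 3 m = (if aprimedivisor m \<notin> {2, 3} \<and> chi12 (aprimedivisor m) = -1 then mangoldt m else 0)
     + (if aprimedivisor m = 3 then mangoldt m else 0)"
proof -
  have *: "Lambda_g 4 1 m = (if aprimedivisor m \<notin> {2, 3} \<and> chi12 (aprimedivisor m) = 1 then mangoldt m else 0) \<and>
    Lambda_g 4 3 m = (if aprimedivisor m \<notin> {2, 3} \<and> chi12 (aprimedivisor m) = -1 then mangoldt m else 0)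
     + (if aprimedivisor m = 3 then mangoldt m else 0)"
  proof (cases "m > 1")
    case True
    have c: "[int p = 1] (mod 4) \<longleftrightarrow> p mod 4 = 1" "[int p = 3] (mod 4) \<longleftrightarrow> p mod 4 = 3" for p
      using cong_nat_int[of p 1 4] cong_nat_int[of p 3 4] by simp_all
    show ?thesis using True
    proof (cases rule: aprimedivisor_cases)
      case (3 r)
      then show ?thesis using mod_12_cases[OF 3(1)] unfolding Lambda_g_eq c by (elim insertE) (simp_all add: chi12_def)
    qed (simp_all only: Lambda_g_eq c, simp_all)
  next
    case False
    then have "m = 0 \<or> m = 1" by auto
    then show ?thesis by (auto simp: Lambda_g_eq)
  qed
  from * show "Lambda_g 4 1 m = (if aprimedivisor m \<notin> {2, 3} \<and> chi12 (aprimedivisor m) = 1 then mangoldt m else 0)" ..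
  from * show "Lambda_g 4 3 m = (if aprimedivisor m \<notin> {2, 3} \<and> chi12 (aprimedivisor m) = -1 then mangoldt m else 0)
     + (if aprimedivisor m = 3 then mangoldt m else 0)" ..
qed

lemma Lambda_g_3:
  "Lambda_g 3 1 m = (if aprimedivisor m \<notin> {2, 3} \<and> chi6 (aprimedivisor m) = 1 then mangoldt m else 0)"
  "Lambda_g 3 2 m = (if aprimedivisor m \<notin> {2, 3} \<and> chi6 (aprimedivisor m) = -1 then mangoldt m else 0)
     + (if aprimedivisor m = 2 then mangoldt m else 0)"
proof -
  have *: "Lambda_g 3 1 m = (if aprimedivisor m \<notin> {2, 3} \<and> chi6 (aprimedivisor m) = 1 then mangoldt m else 0) \<and>
    Lambda_g 3 2 m = (if aprimedivisor m \<notin> {2, 3} \<and> chi6 (aprimedivisor m) = -1 then mangoldt m else 0)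
     + (if aprimedivisor m = 2 then mangoldt m else 0)"
  proof (cases "m > 1")
    case True
    have c: "[int p = 1] (mod 3) \<longleftrightarrow> p mod 3 = 1" "[int p = 2] (mod 3) \<longleftrightarrow> p mod 3 = 2" for p
      using cong_nat_int[of p 1 3] cong_nat_int[of p 2 3] by simp_all
    show ?thesis using True
    proof (cases rule: aprimedivisor_cases)
      case (3 r)
      then show ?thesis using mod_12_cases[OF 3(1)] unfolding Lambda_g_eq c by (elim insertE) (simp_all add: chi6_def)
    qed (simp_all only: Lambda_g_eq c, simp_all)
  next
    case False
    then have "m = 0 \<or> m = 1" by auto
    then show ?thesis by (auto simp: Lambda_g_eq)
  qed
  from * show "Lambda_g 3 1 m = (if aprimedivisor m \<notin> {2, 3} \<and> chi6 (aprimedivisor m) = 1 then mangoldt m else 0)" ..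
  from * show "Lambda_g 3 2 m = (if aprimedivisor m \<notin> {2, 3} \<and> chi6 (aprimedivisor m) = -1 then mangoldt m else 0)
     + (if aprimedivisor m = 2 then mangoldt m else 0)" ..
qed

lemma chi_values [simp]:
  "chi12 1 = 1" "chi12 2 = 0" "chi12 3 = 0" "chi6 1 = 1" "chi6 2 = 0" "chi6 3 = 0"
  by (simp_all add: chi12_def chi6_def)

lemmas split_chi12 = split_coprime_6[OF chi12_mult chi_values(1-3) chi12_prime]
lemmas split_chi6 = split_coprime_6[OF chi6_mult chi_values(4-6) chi6_prime]

text \<open>Restoring the prime 3 to its class mod 4, or 2 to its class mod 3, adds its part twice
  after doubling and so reverses the sign of that \<open>p_part\<close>.\<close>

lemma two_H_nat:
  "2 * H_nat 4 1 n = msum (\<lambda>_. 1) n + chi_msum chi12 n - p_part 2 n - p_part 3 n - 2 * even_part chi12 n"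
  "2 * H_nat 4 3 n = msum (\<lambda>_. 1) n - chi_msum chi12 n - p_part 2 n + p_part 3 n + 2 * even_part chi12 n"
  "2 * H_nat 3 1 n = msum (\<lambda>_. 1) n + chi_msum chi6 n - p_part 2 n - p_part 3 n - 2 * even_part chi6 n"
  "2 * H_nat 3 2 n = msum (\<lambda>_. 1) n - chi_msum chi6 n + p_part 2 n - p_part 3 n + 2 * even_part chi6 n"
proof -
  note defs = H_nat_def msum_def p_part_def even_part_def sum_distrib_left sum.distrib[symmetric] sum_subtractf[symmetric]
  define q where "q p m = (if aprimedivisor m = p then mangoldt m else (0::real))" for p m
  have L: "2 * Lambda_g 4 1 m = mangoldt m + of_int (chi12 m) * mangoldt m - q 2 m - q 3 m
      - 2 * (if chi12 m = 1 then neg_mangoldt chi12 m else 0)"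
    "2 * Lambda_g 4 3 m = mangoldt m - of_int (chi12 m) * mangoldt m - q 2 m + q 3 m
      + 2 * (if chi12 m = 1 then neg_mangoldt chi12 m else 0)"
    "2 * Lambda_g 3 1 m = mangoldt m + of_int (chi6 m) * mangoldt m - q 2 m - q 3 m
      - 2 * (if chi6 m = 1 then neg_mangoldt chi6 m else 0)"
    "2 * Lambda_g 3 2 m = mangoldt m - of_int (chi6 m) * mangoldt m + q 2 m - q 3 m
      + 2 * (if chi6 m = 1 then neg_mangoldt chi6 m else 0)" for m
    using split_chi12[of m] split_chi6[of m] unfolding Lambda_g_4 Lambda_g_3 distrib_left[of 2] q_def by - linarith+
  have eq: "2 * (x / real m) = (2 * x) / real m" for x m by simp
  show "2 * H_nat 4 1 n = msum (\<lambda>_. 1) n + chi_msum chi12 n - p_part 2 n - p_part 3 n - 2 * even_part chi12 n"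
    unfolding defs eq L q_def[symmetric]
    by (rule sum.cong) (simp_all add: add_divide_distrib diff_divide_distrib mult.commute)
  show "2 * H_nat 4 3 n = msum (\<lambda>_. 1) n - chi_msum chi12 n - p_part 2 n + p_part 3 n + 2 * even_part chi12 n"
    unfolding defs eq L q_def[symmetric]
    by (rule sum.cong) (simp_all add: add_divide_distrib diff_divide_distrib mult.commute)
  show "2 * H_nat 3 1 n = msum (\<lambda>_. 1) n + chi_msum chi6 n - p_part 2 n - p_part 3 n - 2 * even_part chi6 n"
    unfolding defs eq L q_def[symmetric]
    by (rule sum.cong) (simp_all add: add_divide_distrib diff_divide_distrib mult.commute)
  show "2 * H_nat 3 2 n = msum (\<lambda>_. 1) n - chi_msum chi6 n + p_part 2 n - p_part 3 n + 2 * even_part chi6 n"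
    unfolding defs eq L q_def[symmetric]
    by (rule sum.cong) (simp_all add: add_divide_distrib diff_divide_distrib mult.commute)
qed

section \<open>Bounds for the powers of 2 and 3 and for the even powers\<close>

lemma sum_inverse_powers:
  fixes p :: nat
  assumes "p \<ge> 2"
  shows "(\<Sum>r\<in>{1..R}. ln (real p) / real (p ^ r)) = ln (real p) / (real p - 1) * (1 - 1 / real p ^ R)"
proof (induction R)
  case (Suc R)
  then show ?case using assms by (simp add: divide_simps) (simp add: algebra_simps)
qed simp

lemma p_part_bounds:
  assumes p: "prime p"
  shows "p_part p n \<le> ln (real p) / (real p - 1)"
    and "p ^ R \<le> n \<Longrightarrow> ln (real p) / (real p - 1) * (1 - 1 / real p ^ R) \<le> p_part p n"
proof -
  have p2: "p \<ge> 2" using p prime_ge_2_nat by blast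
  define g where "g m = (if aprimedivisor m = p then mangoldt m else 0) / real m" for m
  have g_nn: "g m \<ge> 0" for m by (simp add: g_def mangoldt_nonneg)
  have img: "(\<Sum>m\<in>(\<lambda>r. p ^ r) ` {1..R}. g m) = ln (real p) / (real p - 1) * (1 - 1 / real p ^ R)" for R
  proof -
    have "(\<Sum>m\<in>(\<lambda>r. p ^ r) ` {1..R}. g m) = (\<Sum>r\<in>{1..R}. g (p ^ r))"
      using p2 by (subst sum.reindex) (auto intro!: inj_onI simp: power_inject_exp)
    also have "\<dots> = (\<Sum>r\<in>{1..R}. ln (real p) / real (p ^ r))"
      using p by (intro sum.cong) (simp_all add: g_def aprimedivisor_prime_power)
    finally show ?thesis using sum_inverse_powers[OF p2] by simp
  qed
  have "p_part p n = (\<Sum>m\<in>{m\<in>{1..n}. g m \<noteq> 0}. g m)"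
    unfolding p_part_def g_def[symmetric] by (intro sum.mono_neutral_right) auto
  also have "\<dots> \<le> (\<Sum>m\<in>(\<lambda>r. p ^ r) ` {1..n}. g m)"
  proof (rule sum_mono2)
    show "{m\<in>{1..n}. g m \<noteq> 0} \<subseteq> (\<lambda>r. p ^ r) ` {1..n}"
    proof
      fix m assume m: "m \<in> {m\<in>{1..n}. g m \<noteq> 0}"
      then have "primepow m" "aprimedivisor m = p" by (auto simp: g_def mangoldt_def split: if_splits)
      then obtain k where k: "k > 0" "m = p ^ k" by (auto simp: primepow_def aprimedivisor_prime_power)
      have "k < p ^ k" using p2 by (intro power_gt_expt) auto
      then show "m \<in> (\<lambda>r. p ^ r) ` {1..n}" using m k by auto
    qed
  qed (use g_nn in auto)
  also have "\<dots> \<le> ln (real p) / (real p - 1) * 1"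
    unfolding img using p2 by (intro mult_left_mono) auto
  finally show "p_part p n \<le> ln (real p) / (real p - 1)" by simp
  assume R: "p ^ R \<le> n"
  have "(\<Sum>m\<in>(\<lambda>r. p ^ r) ` {1..R}. g m) \<le> p_part p n"
    unfolding p_part_def g_def[symmetric]
  proof (rule sum_mono2)
    show "(\<lambda>r. p ^ r) ` {1..R} \<subseteq> {1..n}"
    proof
      fix m assume "m \<in> (\<lambda>r. p ^ r) ` {1..R}"
      then obtain r where r: "m = p ^ r" "r \<le> R" by auto
      have "p ^ r \<le> p ^ R" using r p2 by (intro power_increasing) auto
      then have "p ^ r \<le> n" using R by linarith
      then show "m \<in> {1..n}" using r p2 by (auto simp: Suc_le_eq)
    qed
  qed (use g_nn in auto)
  then show "ln (real p) / (real p - 1) * (1 - 1 / real p ^ R) \<le> p_part p n" unfolding img .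
qed

lemma neg_mangoldt_nonneg: "neg_mangoldt chi m \<ge> 0"
  by (simp add: neg_mangoldt_def mangoldt_nonneg)

lemma even_part_nonneg: "even_part chi n \<ge> 0"
  unfolding even_part_def by (intro sum_nonneg) (simp add: neg_mangoldt_nonneg)

text \<open>
  A prime power \<open>m = p ^ k\<close> with \<open>chi p = -1\<close> and \<open>chi m = 1\<close> is the square of \<open>q = p ^ (k div 2)\<close>.
\<close>

lemma even_part_le:
  fixes chi :: "nat \<Rightarrow> int"
  assumes mult: "\<And>m n. chi (m * n) = chi m * chi n" "chi 1 = 1"
  shows "even_part chi n \<le> (\<Sum>q\<in>{1..n}. neg_mangoldt chi q / real q ^ 2)"
proof -
  define g where "g m = (if chi m = 1 then neg_mangoldt chi m else 0) / real m" for m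
  have g_nn: "g m \<ge> 0" for m by (simp add: g_def neg_mangoldt_nonneg)
  have "even_part chi n = (\<Sum>m\<in>{m\<in>{1..n}. g m \<noteq> 0}. g m)"
    unfolding even_part_def g_def[symmetric] by (intro sum.mono_neutral_right) auto
  also have "\<dots> \<le> (\<Sum>m\<in>(\<lambda>q. q\<^sup>2) ` {1..n}. g m)"
  proof (rule sum_mono2)
    show "{m\<in>{1..n}. g m \<noteq> 0} \<subseteq> (\<lambda>q. q\<^sup>2) ` {1..n}"
    proof
      fix m assume m: "m \<in> {m\<in>{1..n}. g m \<noteq> 0}"
      then have m': "primepow m" "chi (aprimedivisor m) = -1" "chi m = 1"
        by (auto simp: g_def neg_mangoldt_def mangoldt_def split: if_splits)
      then obtain p k where p: "prime p" "k > 0" "m = p ^ k" by (auto simp: primepow_def)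
      have "(-1) ^ k = (1 :: int)" using m' p chi_power[of chi, OF mult, of p k] by (simp add: aprimedivisor_prime_power)
      then have "even k" by (auto simp: minus_one_power_iff split: if_splits)
      then obtain j where j: "k = 2 * j" by auto
      have "p ^ j \<le> p ^ k" using j prime_gt_0_nat[OF p(1)] by (intro power_increasing) auto
      then have "p ^ j \<in> {1..n}" using m p prime_gt_0_nat[OF p(1)] by (auto simp: Suc_le_eq)
      moreover have "m = (p ^ j)\<^sup>2" using p j by (simp add: power_mult mult.commute)
      ultimately show "m \<in> (\<lambda>q. q\<^sup>2) ` {1..n}" by blast
    qed
  qed (use g_nn in auto)
  also have "\<dots> = (\<Sum>q\<in>{1..n}. g (q\<^sup>2))"
    by (subst sum.reindex) (auto intro!: inj_onI)
  also have "\<dots> \<le> (\<Sum>q\<in>{1..n}. neg_mangoldt chi q / real q ^ 2)"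
  proof (rule sum_mono)
    fix q assume q: "q \<in> {1..n}"
    have "neg_mangoldt chi (q\<^sup>2) = neg_mangoldt chi q"
      using q by (auto simp: neg_mangoldt_def mangoldt_def primepow_power_iff_nat aprimedivisor_primepow_power)
    then show "g (q\<^sup>2) \<le> neg_mangoldt chi q / real q ^ 2"
      by (auto simp: g_def neg_mangoldt_nonneg)
  qed
  finally show ?thesis .
qed

text \<open>Telescoping against -(ln t + 1)/t, a primitive of ln t / t^2. One step reduces to ln (1
  + 1/x) <= 1/x together with ln x >= 1, hence M >= 3.\<close>

lemma sum_ln_over_square:
  assumes "M \<ge> 3" "M \<le> n"
  shows "(\<Sum>q\<in>{Suc M..n}. ln (real q) / real q ^ 2) \<le> (ln (real M) + 1) / real M - (ln (real n) + 1) / real n"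
  using assms(2)
proof (induction n rule: dec_induct)
  case (step n)
  define x where "x = real n"
  define d where "d = ln (x + 1) - ln x"
  have x: "x \<ge> 3" using step assms(1) by (simp add: x_def)
  have "d = ln (1 + 1 / x)" using x ln_div[of "x + 1" x] by (simp add: d_def add_divide_distrib)
  also have "\<dots> \<le> 1 / x" using x by (intro ln_add_one_self_le_self) auto
  finally have d: "x * d \<le> 1" using x by (simp add: field_simps)
  have "exp 1 \<le> x" using exp_le x by linarith
  then have lx: "1 \<le> ln x" using x by (subst ln_ge_iff) auto
  have "x * ln (x + 1) \<le> (x + 1) * (ln x + 1 - x * d)"
  proof -
    have "(x + 1) * (ln x + 1 - x * d) - x * ln (x + 1) = (ln x - x * d) + (x + 1) * (1 - x * d)"
      by (simp add: d_def algebra_simps)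
    moreover have "(x + 1) * (1 - x * d) \<ge> 0" using x d by (intro mult_nonneg_nonneg) auto
    ultimately show ?thesis using lx d by linarith
  qed
  then have "ln (x + 1) / (x + 1)\<^sup>2 \<le> (ln x + 1 - x * d) / (x * (x + 1))"
    using x by (simp add: divide_simps power2_eq_square) (simp add: algebra_simps)
  also have "\<dots> = (ln x + 1) / x - (ln (x + 1) + 1) / (x + 1)"
    using x by (simp add: d_def divide_simps) (simp add: algebra_simps)
  finally have "ln (real (Suc n)) / real (Suc n) ^ 2 \<le> (ln x + 1) / x - (ln (real (Suc n)) + 1) / real (Suc n)"
    by (simp add: x_def add.commute)
  moreover have "(\<Sum>q\<in>{Suc M..Suc n}. ln (real q) / real q ^ 2)
    = (\<Sum>q\<in>{Suc M..n}. ln (real q) / real q ^ 2) + ln (real (Suc n)) / real (Suc n) ^ 2"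
    using step by (simp add: sum.atLeast_Suc_atMost)
  ultimately show ?case using step.IH by (simp add: x_def)
qed simp

lemma even_part_le_1000:
  fixes chi :: "nat \<Rightarrow> int"
  assumes mult: "\<And>m n. chi (m * n) = chi m * chi n" "chi 1 = 1" and n: "n \<ge> 1000"
    and c: "(\<Sum>q\<in>{1..1000}. neg_mangoldt chi q / real q ^ 2) \<le> c"
  shows "even_part chi n \<le> c + 8/1000"
proof -
  have "even_part chi n \<le> (\<Sum>q\<in>{1..n}. neg_mangoldt chi q / real q ^ 2)"
    using even_part_le[of chi, OF mult] .
  also have "{1..n} = {1..1000} \<union> {Suc 1000..n}" using n by auto
  also have "(\<Sum>q\<in>\<dots>. neg_mangoldt chi q / real q ^ 2) = (\<Sum>q\<in>{1..1000}. neg_mangoldt chi q / real q ^ 2)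
     + (\<Sum>q\<in>{Suc 1000..n}. neg_mangoldt chi q / real q ^ 2)"
    by (intro sum.union_disjoint) auto
  also have "(\<Sum>q\<in>{Suc 1000..n}. neg_mangoldt chi q / real q ^ 2) \<le> (\<Sum>q\<in>{Suc 1000..n}. ln (real q) / real q ^ 2)"
    by (intro sum_mono divide_right_mono) (auto simp: neg_mangoldt_def mangoldt_le)
  also have "\<dots> \<le> (ln (real 1000) + 1) / real 1000 - (ln (real n) + 1) / real n"
    using n by (intro sum_ln_over_square) auto
  also have "\<dots> \<le> 8/1000"
  proof -
    have "(ln (real n) + 1) / real n \<ge> 0" using n by simp
    moreover have "(ln (real 1000) + 1) / real 1000 \<le> 8/1000" using ln_le_1000[of 1000] by simp
    ultimately show ?thesis by linarith
  qed
  finally show ?thesis using c by simp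
qed

section \<open>Interval computation up to 1000\<close>

text \<open>The value 0 means that n is none of the listed powers of p. Exponents up to 9 suffice
  for n < 1024 = 2^10.\<close>

definition exponent_of :: "int \<Rightarrow> int \<Rightarrow> int" where
  "exponent_of p n = (if n = p then 1 else if n = p*p then 2 else if n = p*p*p then 3
     else if n = p*p*p*p then 4 else if n = p*p*p*p*p then 5 else if n = p*p*p*p*p*p then 6
     else if n = p*p*p*p*p*p*p then 7 else if n = p*p*p*p*p*p*p*p then 8
     else if n = p*p*p*p*p*p*p*p*p then 9 else 0)"

primrec first_divisor :: "int list \<Rightarrow> int \<Rightarrow> int" where
  "first_divisor [] n = n"
| "first_divisor (p # ps) n = (if n mod p = 0 then p else first_divisor ps n)"

text \<open>Trial division by the primes up to 31 decides primality below 1024 = 32^2.\<close>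

definition small_factor :: "int \<Rightarrow> int" where
  "small_factor n = first_divisor [2,3,5,7,11,13,17,19,23,29,31] n"

definition primepow_data :: "int \<Rightarrow> int \<times> int" where
  "primepow_data n = (small_factor n, exponent_of (small_factor n) n)"

type_synonym ivl = "int \<times> int"

definition ivl_add :: "ivl \<Rightarrow> ivl \<Rightarrow> ivl" where
  "ivl_add a b = (case a of (l, u) \<Rightarrow> case b of (l', u') \<Rightarrow> (l + l', u + u'))"

text \<open>Outward rounding for a positive divisor: floor below, and the ceiling written as a
  negated floor above.\<close>

definition ivl_div :: "ivl \<Rightarrow> int \<Rightarrow> ivl" where
  "ivl_div a n = (case a of (l, u) \<Rightarrow> (l div n, - ((- u) div n)))"

definition ivl_sgn :: "int \<Rightarrow> ivl \<Rightarrow> ivl" where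
  "ivl_sgn s a = (if s = 0 then (0, 0) else if s = 1 then a else (case a of (l, u) \<Rightarrow> (- u, - l)))"

text \<open>
  For \<open>z = 2 n + 1\<close>, the increment \<open>ln (n + 1) - ln n = 2 artanh (1 / z)\<close> lies between
  \<open>2 / z + 2 / (3 z\<^sup>3)\<close> and \<open>2 / z + 2 / (3 z (z\<^sup>2 - 1))\<close>. All intervals are scaled by \<open>10\<^sup>7\<close>.
\<close>

definition ln_incr :: "int \<Rightarrow> ivl" where
  "ln_incr z = (20000000 div z + 20000000 div (3 * z * z * z),
     - ((- 20000000) div z) - ((- 20000000) div (3 * z * (z * z - 1))))"

definition chi12i :: "int \<Rightarrow> int" where
  "chi12i n = (let r = n mod 12 in if r = 1 \<or> r = 5 then 1 else if r = 7 \<or> r = 11 then -1 else 0)"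

definition chi6i :: "int \<Rightarrow> int" where
  "chi6i n = (let r = n mod 6 in if r = 1 then 1 else if r = 5 then -1 else 0)"

definition indic :: "bool \<Rightarrow> int" where "indic b = (if b then 1 else 0)"

text \<open>In order: the four sums \<open>H_nat\<close> (1 and 3 mod 4, 1 and 2 mod 3), the sum of
  \<open>mangoldt n / n\<close>, its twists by \<open>chi12\<close> and \<open>chi6\<close>, the two
  \<open>chi_ln_sum\<close>, \<open>psi\<close>, and the two sums of \<open>neg_mangoldt\<close>
  over squares.\<close>

datatype columns = Columns ivl ivl ivl ivl ivl ivl ivl ivl ivl ivl ivl ivl

fun update_ln :: "int \<Rightarrow> ivl \<Rightarrow> columns \<Rightarrow> columns" where
  "update_ln n g (Columns a1 a2 a3 a4 a5 a6 a7 a8 a9 a10 a11 a12) =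
     Columns a1 a2 a3 a4 a5 a6 a7 (ivl_add a8 (ivl_sgn (chi12i n) g)) (ivl_add a9 (ivl_sgn (chi6i n) g)) a10 a11 a12"

fun update_mangoldt :: "int \<Rightarrow> int \<Rightarrow> ivl \<Rightarrow> ivl \<Rightarrow> ivl \<Rightarrow> columns \<Rightarrow> columns" where
  "update_mangoldt n p v g h (Columns a1 a2 a3 a4 a5 a6 a7 a8 a9 a10 a11 a12) =
     Columns (ivl_add a1 (ivl_sgn (indic (p mod 4 = 1)) g)) (ivl_add a2 (ivl_sgn (indic (p mod 4 = 3)) g))
       (ivl_add a3 (ivl_sgn (indic (p mod 3 = 1)) g)) (ivl_add a4 (ivl_sgn (indic (p mod 3 = 2)) g))
       (ivl_add a5 g) (ivl_add a6 (ivl_sgn (chi12i n) g)) (ivl_add a7 (ivl_sgn (chi6i n) g))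
       a8 a9 (ivl_add a10 v)
       (ivl_add a11 (ivl_sgn (indic (chi12i p = -1)) h)) (ivl_add a12 (ivl_sgn (indic (chi6i p = -1)) h))"

definition update_mangoldt2 :: "int \<Rightarrow> int \<Rightarrow> ivl \<Rightarrow> ivl \<Rightarrow> columns \<Rightarrow> columns" where
  "update_mangoldt2 n p v g s = update_mangoldt n p v g (ivl_div g n) s"

definition update_mangoldt1 :: "int \<Rightarrow> int \<Rightarrow> ivl \<Rightarrow> columns \<Rightarrow> columns" where
  "update_mangoldt1 n p v s = update_mangoldt2 n p v (ivl_div v n) s"

text \<open>For n = p^r the value ln p is taken as ln n / r, so the running logarithm of n is the
  only one required.\<close>

fun update_primepow :: "int \<Rightarrow> ivl \<Rightarrow> int \<times> int \<Rightarrow> columns \<Rightarrow> columns" where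
  "update_primepow n l (p, r) s = (if r = 0 then s else update_mangoldt1 n p (ivl_div l r) s)"

definition update :: "int \<Rightarrow> ivl \<Rightarrow> columns \<Rightarrow> columns" where
  "update n l s = update_ln n (ivl_div l n) (update_primepow n l (primepow_data n) s)"

text \<open>
  The lower bounds for the classes 3 mod 4 and 2 mod 3 are only tested from 7 and 4 on, since the
  infima are attained in the limits \<open>x \<rightarrow> 7\<close> and \<open>x \<rightarrow> 4\<close> from the left. The thresholds 166, 90 and 200
  are \<open>1000 div 6\<close>, \<open>1000 div 11\<close> and \<open>1000 div 5\<close>: from there on the recurrences need initial values.
\<close>

fun row_check :: "int \<Rightarrow> ivl \<Rightarrow> ivl \<Rightarrow> columns \<Rightarrow> bool" where
  "row_check n (l, u) (l', u') (Columns h41 h43 h31 h32 mm x12 x6 t12 t6 ps e12 e6) \<longleftrightarrow>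
     u' - 24000000 \<le> 2 * fst h41 \<and> 2 * snd h41 \<le> l \<and>
     (7 \<le> n \<longrightarrow> u' - 12132000 \<le> 2 * fst h43) \<and> 2 * snd h43 \<le> l \<and>
     u' - 27800000 \<le> 2 * fst h31 \<and> 2 * snd h31 \<le> l \<and>
     (4 \<le> n \<longrightarrow> u' - 6930000 \<le> 2 * fst h32) \<and> 2 * snd h32 \<le> l + 5400000 \<and>
     (166 \<le> n \<longrightarrow> u - 7282000 \<le> fst mm \<and> snd mm \<le> l - 4192000) \<and>
     (90 \<le> n \<longrightarrow> - 1760000 \<le> fst x12 \<and> snd x12 \<le> 2340000) \<and>
     (200 \<le> n \<longrightarrow> - 3693000 \<le> fst x6 \<and> snd x6 \<le> 947000) \<and>
     snd ps \<le> 11500000 * n"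

fun final_check :: "columns \<Rightarrow> bool" where
  "final_check (Columns h41 h43 h31 h32 mm x12 x6 t12 t6 ps e12 e6) \<longleftrightarrow>
     294000 \<le> fst t12 \<and> snd t12 \<le> 314000 \<and> - 1232000 \<le> fst t6 \<and> snd t6 \<le> - 1212000 \<and>
     snd e12 \<le> 930000 \<and> snd e6 \<le> 1240000"

text \<open>\<open>l\<close> encloses the logarithm of the head n. A row is tested with this and
  with the enclosure at n + 1, because the lower bounds have to hold up to the next integer.\<close>

fun loop :: "int list \<Rightarrow> ivl \<Rightarrow> columns \<Rightarrow> bool" and
  loop_step :: "int \<Rightarrow> int list \<Rightarrow> ivl \<Rightarrow> ivl \<Rightarrow> columns \<Rightarrow> bool" where
  "loop [] l s = final_check s"
| "loop (n # ns) l s = loop_step n ns l (ivl_add l (ln_incr (2 * n + 1))) (update n l s)"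
| "loop_step n ns l l' s = (if row_check n l l' s then loop ns l' s else False)"

definition initial_columns :: columns where
  "initial_columns = Columns (0,0) (0,0) (0,0) (0,0) (0,0) (0,0) (0,0) (0,0) (0,0) (0,0) (0,0) (0,0)"

section \<open>Correctness of the enclosures\<close>

definition approx :: "ivl \<Rightarrow> real \<Rightarrow> bool" where
  "approx a x \<longleftrightarrow> of_int (fst a) \<le> 10000000 * x \<and> 10000000 * x \<le> of_int (snd a)"

lemma approx_0: "approx (0, 0) 0"
  by (simp add: approx_def)

lemma approx_add: "approx a x \<Longrightarrow> approx b y \<Longrightarrow> approx (ivl_add a b) (x + y)"
  by (auto simp: approx_def ivl_add_def split: prod.splits)

lemma ceiling_div_ge: "of_int a / of_int n \<le> - real_of_int ((- a) div n)"
  using real_of_int_div4[of "- a" n] by simp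

lemma approx_div:
  assumes "n > 0" "approx a x"
  shows "approx (ivl_div a n) (x / of_int n)"
proof -
  have "of_int (fst a) / of_int n \<le> 10000000 * x / of_int n" "10000000 * x / of_int n \<le> of_int (snd a) / of_int n"
    using assms by (auto simp: approx_def intro!: divide_right_mono)
  with real_of_int_div4[of "fst a" n] ceiling_div_ge[of "snd a" n] show ?thesis
    by (auto simp: approx_def ivl_div_def split: prod.splits)
qed

lemma approx_sgn:
  assumes "s \<in> {-1, 0, 1}" "approx a x"
  shows "approx (ivl_sgn s a) (of_int s * x)"
  using assms by (auto simp: approx_def ivl_sgn_def split: prod.splits)

lemma approx_ln_incr:
  fixes n :: nat
  assumes "n > 0"
  shows "approx (ln_incr (2 * int n + 1)) (ln (real n + 1) - ln (real n))"
proof -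
  define z where "z = 2 * real n + 1"
  have z: "z > 1" using assms by (simp add: z_def)
  define x where "x = (real n + 1) / real n"
  have x: "x > 1" using assms by (simp add: x_def)
  have y: "(x - 1) / (x + 1) = 1 / z" using assms by (simp add: x_def z_def field_simps)
  have ln: "ln (real n + 1) - ln (real n) = ln x" using assms by (simp add: x_def ln_div)
  have lo: "2 / z + 2 / (3 * z ^ 3) \<le> ln x"
    using ln_approx_bounds[OF x, of 2, unfolded y] by (simp add: numeral_eq_Suc power_divide)
  have hi: "ln x \<le> 2 / z + 2 / (3 * z * (z ^ 2 - 1))"
  proof -
    have "ln x \<le> 2 * (1 / z) + 2 * ((1 / z) ^ 3 / 3 / (1 - (1 / z)\<^sup>2))"
      using ln_approx_bounds[OF x, of 1, unfolded y] by (simp add: numeral_eq_Suc)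
    also have "(1 / z) ^ 3 / 3 / (1 - (1 / z)\<^sup>2) = 1 / (3 * z * (z ^ 2 - 1))"
      using z by (simp add: divide_simps power2_eq_square power3_eq_cube)
    finally show ?thesis by simp
  qed
  define Z where "Z = 2 * int n + 1"
  have zi: "real_of_int Z = z" by (simp add: z_def Z_def)
  have "real_of_int (20000000 div Z) \<le> 20000000 / z"
    using real_of_int_div4[of 20000000 Z] by (simp add: zi)
  moreover have "real_of_int (20000000 div (3 * Z * Z * Z)) \<le> 20000000 / (3 * z ^ 3)"
    using real_of_int_div4[of 20000000 "3 * Z * Z * Z"] by (simp add: zi power3_eq_cube mult_ac)
  moreover have "20000000 / z \<le> - real_of_int ((- 20000000) div Z)"
    using ceiling_div_ge[of 20000000 Z] by (simp add: zi)
  moreover have "20000000 / (3 * z * (z ^ 2 - 1)) \<le> - real_of_int ((- 20000000) div (3 * Z * (Z * Z - 1)))"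
    using ceiling_div_ge[of 20000000 "3 * Z * (Z * Z - 1)"] by (simp add: zi power2_eq_square)
  moreover have "10000000 * (2 / z + 2 / (3 * z ^ 3)) \<le> 10000000 * ln x"
    "10000000 * ln x \<le> 10000000 * (2 / z + 2 / (3 * z * (z ^ 2 - 1)))"
    using lo hi by (intro mult_left_mono; simp)+
  ultimately show ?thesis
    unfolding Z_def[symmetric] approx_def ln_incr_def ln fst_conv snd_conv of_int_add of_int_diff of_int_minus
    by (simp add: distrib_left)
qed

lemma first_divisor_cases:
  "(first_divisor ps n \<in> set ps \<and> first_divisor ps n dvd n) \<or> (first_divisor ps n = n \<and> (\<forall>p\<in>set ps. \<not> p dvd n))"
  by (induction ps) (auto simp: dvd_eq_mod_eq_0)

lemma prime_le_31:
  assumes "prime (p::nat)" "p \<le> 31"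
  shows "p \<in> {2,3,5,7,11,13,17,19,23,29,31}"
proof -
  have "\<not> 2 dvd p \<or> p = 2" "\<not> 3 dvd p \<or> p = 3" "\<not> 5 dvd p \<or> p = 5" "p \<noteq> 1" "p > 0"
    using assms(1) primes_dvd_imp_eq[of 2 p] primes_dvd_imp_eq[of 3 p] primes_dvd_imp_eq[of 5 p] prime_gt_0_nat
    by auto
  with assms(2) show ?thesis by (simp, presburger)
qed

lemma small_factor_prime:
  assumes "2 \<le> n" "n < 1024"
  obtains p where "small_factor (int n) = int p" "prime p" "p dvd n" "p = n \<or> p \<le> 31"
proof -
  let ?ps = "[2,3,5,7,11,13,17,19,23,29,31] :: int list"
  consider "small_factor (int n) \<in> set ?ps" "small_factor (int n) dvd int n"
    | "small_factor (int n) = int n" "\<forall>p\<in>set ?ps. \<not> p dvd int n"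
    using first_divisor_cases[of ?ps "int n"] unfolding small_factor_def by blast
  then show ?thesis
  proof cases
    case 1
    define p where "p = nat (small_factor (int n))"
    have p: "p \<in> {2,3,5,7,11,13,17,19,23,29,31}" "small_factor (int n) = int p"
      using 1(1) by (auto simp: p_def)
    have "prime p" "p \<le> 31" using p(1) by (elim insertE; simp)+
    moreover have "p dvd n" using 1(2) p(2) by (simp add: int_dvd_int_iff)
    ultimately show ?thesis using that p(2) by blast
  next
    case 2
    have "prime n"
    proof (rule ccontr)
      assume "\<not> prime n"
      \<comment> \<open>If q is the least prime divisor of a composite n, the cofactor has a prime
        divisor at least q, so q^2 <= n < 32^2 and q is in the list.\<close>
      define q where "q = (LEAST q. prime q \<and> q dvd n)"
      obtain q0 where "prime q0 \<and> q0 dvd n" using prime_factor_nat[of n] assms by auto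
      then have q: "prime q" "q dvd n" "\<And>r. prime r \<Longrightarrow> r dvd n \<Longrightarrow> q \<le> r"
        unfolding q_def by (metis (mono_tags, lifting) LeastI, metis (mono_tags, lifting) LeastI, metis (mono_tags, lifting) Least_le)
      obtain m where m: "n = q * m" using q(2) by (auto simp: dvd_def)
      have "m \<noteq> 1" using m q(1) \<open>\<not> prime n\<close> by auto
      then obtain r where "prime r" "r dvd m" using prime_factor_nat by auto
      moreover have "m > 0" using m assms by (cases m) auto
      ultimately have "q \<le> r" "r \<le> m" using q(3)[of r] m by (auto intro: dvd_imp_le)
      then have "q * q \<le> n" using m by (simp add: order.trans)
      then have "q * q < 32 * 32" using assms by simp
      then have "q < 32" using mult_le_mono[of 32 q 32 q] by linarith
      then have "q \<le> 31" by simp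
      then have "int q \<in> set ?ps" using prime_le_31[OF q(1)] by auto
      with 2(2) have "\<not> int q dvd int n" by blast
      with q(2) show False by (simp add: int_dvd_int_iff)
    qed
    then show ?thesis using that[of n] 2 by simp
  qed
qed

lemma exponent_of_cases: "exponent_of p n = 0 \<or> (exponent_of p n > 0 \<and> n = p ^ nat (exponent_of p n))"
  by (simp add: exponent_of_def numeral_eq_Suc)

lemma exponent_of_power:
  assumes "k > 0" "k < 10"
  shows "exponent_of p (p ^ k) \<noteq> 0"
proof -
  have "k \<in> {1,2,3,4,5,6,7,8,9}" using assms by (simp, presburger)
  then show ?thesis by (elim insertE) (simp_all add: exponent_of_def numeral_eq_Suc)
qed

text \<open>Any prime divisor of n will do: a prime power has only one, so if n is not a power of
  the divisor found, with exponent below 10, then n is no prime power.\<close>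

lemma primepow_data_correct:
  assumes n: "2 \<le> n" "n < 1024" and pr: "primepow_data (int n) = (p, r)"
  shows "r = 0 \<Longrightarrow> mangoldt n = (0 :: real)"
    and "r \<noteq> 0 \<Longrightarrow> r > 0 \<and> p = int (aprimedivisor n) \<and> mangoldt n = ln (real n) / of_int r"
proof -
  obtain q where q: "small_factor (int n) = int q" "prime q" "q dvd n" "q = n \<or> q \<le> 31"
    using small_factor_prime[OF n] by blast
  have p: "p = int q" and r: "r = exponent_of (int q) (int n)" using pr q(1) by (auto simp: primepow_data_def)
  show "mangoldt n = (0 :: real)" if "r = 0"
  proof (rule ccontr)
    assume "mangoldt n \<noteq> (0 :: real)"
    then have "primepow n" by (auto simp: mangoldt_def split: if_splits)
    then obtain s k where s: "prime s" "k > 0" "n = s ^ k" by (auto simp: primepow_def)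
    have "s = q" using s q by (metis prime_dvd_power primes_dvd_imp_eq)
    have "2 ^ k \<le> n" unfolding s(3) using prime_ge_2_nat[OF s(1)] by (intro power_mono) auto
    then have "(2::nat) ^ k < 2 ^ 10" using n by simp
    then have "k < 10" by (rule power_less_imp_less_exp[rotated]) simp
    from exponent_of_power[OF s(2) this, of "int q"] that r s \<open>s = q\<close> show False by simp
  qed
  assume "r \<noteq> 0"
  then have r0: "r > 0" "int n = int q ^ nat r" using exponent_of_cases[of "int q" "int n"] r by auto
  then have nq: "n = q ^ nat r" by (metis of_nat_eq_iff of_nat_power)
  have "mangoldt n = ln (real q)" using r0 q(2) by (simp add: nq)
  moreover have "ln (real n) = of_int r * ln (real q)" using r0 prime_gt_0_nat[OF q(2)] by (simp add: nq ln_realpow)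
  moreover have "aprimedivisor n = q" using r0 q(2) by (simp add: nq aprimedivisor_prime_power)
  ultimately show "r > 0 \<and> p = int (aprimedivisor n) \<and> mangoldt n = ln (real n) / of_int r"
    using r0 p by simp
qed

text \<open>The list starts at 2, and the given pair encloses ln 2 scaled by 10^7.\<close>

lemma loop_1000: "loop [2..1000] (6931400, 6931500) initial_columns"
  by code_simp

lemma chi12i_eq: "chi12i (int n) = chi12 n"
proof -
  have "int n mod 12 = int (n mod 12)" by (simp add: zmod_int)
  then show ?thesis by (simp add: chi12i_def chi12_def Let_def)
qed

lemma chi6i_eq: "chi6i (int n) = chi6 n"
proof -
  have "int n mod 6 = int (n mod 6)" by (simp add: zmod_int)
  then show ?thesis by (simp add: chi6i_def chi6_def Let_def)
qed

definition neg_sum :: "(nat \<Rightarrow> int) \<Rightarrow> nat \<Rightarrow> real" where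
  "neg_sum chi n = (\<Sum>q\<in>{1..n}. neg_mangoldt chi q / real q ^ 2)"

fun encloses :: "columns \<Rightarrow> nat \<Rightarrow> bool" where
  "encloses (Columns a1 a2 a3 a4 a5 a6 a7 a8 a9 a10 a11 a12) n \<longleftrightarrow>
     approx a1 (H_nat 4 1 n) \<and> approx a2 (H_nat 4 3 n) \<and> approx a3 (H_nat 3 1 n) \<and> approx a4 (H_nat 3 2 n) \<and>
     approx a5 (msum (\<lambda>_. 1) n) \<and> approx a6 (chi_msum chi12 n) \<and> approx a7 (chi_msum chi6 n) \<and>
     approx a8 (chi_ln_sum chi12 n) \<and> approx a9 (chi_ln_sum chi6 n) \<and> approx a10 (psi n) \<and>
     approx a11 (neg_sum chi12 n) \<and> approx a12 (neg_sum chi6 n)"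

lemma encloses_initial: "encloses initial_columns 1"
  by (simp add: initial_columns_def approx_0 H_nat_def msum_def chi_ln_sum_def psi_def neg_sum_def neg_mangoldt_def Lambda_g_eq)

lemma partial_sums_Suc:
  "H_nat d a (Suc n) = H_nat d a n + Lambda_g d a (Suc n) / real (Suc n)"
  "msum f (Suc n) = msum f n + mangoldt (Suc n) * f (Suc n) / real (Suc n)"
  "chi_ln_sum chi (Suc n) = chi_ln_sum chi n + of_int (chi (Suc n)) * (ln (real (Suc n)) / real (Suc n))"
  "psi (Suc n) = psi n + mangoldt (Suc n)"
  "neg_sum chi (Suc n) = neg_sum chi n + neg_mangoldt chi (Suc n) / real (Suc n) ^ 2"
  by (simp_all add: H_nat_def msum_def chi_ln_sum_def psi_def neg_sum_def)

lemma Lambda_g_indic: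
  assumes "p = int (aprimedivisor n)" "0 < d" "0 \<le> a" "a < d"
  shows "Lambda_g d a n = of_int (indic (p mod d = a)) * mangoldt n"
  using assms by (simp add: Lambda_g_eq indic_def cong_def)

lemma chi12_range: "chi12 n \<in> {-1, 0, 1}" and chi6_range: "chi6 n \<in> {-1, 0, 1}"
  by (auto simp: chi12_def chi6_def)

lemma indic_range: "indic b \<in> {-1, 0, 1}"
  by (simp add: indic_def)

lemma encloses_update:
  assumes s: "encloses s n" and l: "approx l (ln (real (Suc n)))" and n: "1 \<le> n" "n < 1000"
  shows "encloses (update (int (Suc n)) l s) (Suc n)"
proof -
  obtain a1 a2 a3 a4 a5 a6 a7 a8 a9 a10 a11 a12 where s': "s = Columns a1 a2 a3 a4 a5 a6 a7 a8 a9 a10 a11 a12"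
    by (cases s)
  obtain p r where pr: "primepow_data (int (Suc n)) = (p, r)" by force
  note data = primepow_data_correct[OF _ _ pr]
  define N where "N = Suc n"
  have g: "approx (ivl_div l (int N)) (ln (real N) / real N)"
    using approx_div[OF _ l, of "int (Suc n)"] by (simp add: N_def)
  have chis: "chi12i (int N) = chi12 N" "chi6i (int N) = chi6 N" by (rule chi12i_eq chi6i_eq)+
  note cols = s[unfolded s' encloses.simps]
  show ?thesis
  proof (cases "r = 0")
    case True
    then have m: "mangoldt N = (0::real)" using data(1) n by (simp add: N_def)
    then have z: "Lambda_g d a N = 0" "neg_mangoldt chi N = 0" for d a chi
      by (simp_all add: Lambda_g_eq neg_mangoldt_def)
    have update: "update (int (Suc n)) l s = update_ln (int N) (ivl_div l (int N)) s"
      using True by (simp add: update_def pr[folded N_def] N_def[symmetric])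
    show ?thesis
      unfolding update unfolding s' update_ln.simps encloses.simps partial_sums_Suc
      unfolding N_def[symmetric] z m chis mult_zero_left div_0 add_0_right
      using cols g by (intro conjI approx_add approx_sgn chi12_range chi6_range) auto
  next
    case False
    have d: "r > 0" "p = int (aprimedivisor N)" "mangoldt N = ln (real N) / of_int r"
      using data(2) n False by (auto simp: N_def)
    define v where "v = ivl_div l r"
    have v: "approx v (mangoldt N)" unfolding v_def d(3) using approx_div[OF d(1) l] by (simp add: N_def)
    have w: "approx (ivl_div v (int N)) (mangoldt N / real N)"
      using approx_div[OF _ v, of "int N"] by (simp add: N_def)
    have x: "approx (ivl_div (ivl_div v (int N)) (int N)) (mangoldt N / real N ^ 2)"
      using approx_div[OF _ w, of "int N"] by (simp add: N_def power2_eq_square)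
    have L: "Lambda_g 4 1 N / real N = of_int (indic (p mod 4 = 1)) * (mangoldt N / real N)"
      "Lambda_g 4 3 N / real N = of_int (indic (p mod 4 = 3)) * (mangoldt N / real N)"
      "Lambda_g 3 1 N / real N = of_int (indic (p mod 3 = 1)) * (mangoldt N / real N)"
      "Lambda_g 3 2 N / real N = of_int (indic (p mod 3 = 2)) * (mangoldt N / real N)"
      by (simp_all add: Lambda_g_indic[OF d(2)])
    have X: "mangoldt N * of_int c / real N = of_int c * (mangoldt N / real N)" for c by simp
    have E: "neg_mangoldt chi12 N / real N ^ 2 = of_int (indic (chi12i p = -1)) * (mangoldt N / real N ^ 2)"
      "neg_mangoldt chi6 N / real N ^ 2 = of_int (indic (chi6i p = -1)) * (mangoldt N / real N ^ 2)"
      by (simp_all add: neg_mangoldt_def indic_def d(2) chi12i_eq chi6i_eq)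
    have update: "update (int (Suc n)) l s = update_ln (int N) (ivl_div l (int N))
        (update_mangoldt (int N) p v (ivl_div v (int N)) (ivl_div (ivl_div v (int N)) (int N)) s)"
      using False by (simp add: update_def pr[folded N_def] update_mangoldt1_def update_mangoldt2_def v_def N_def[symmetric])
    have one: "mangoldt N * 1 / real N = mangoldt N / real N" by simp
    show ?thesis
      unfolding update unfolding s' update_mangoldt.simps update_ln.simps encloses.simps partial_sums_Suc
      unfolding N_def[symmetric] L X E chis one
      using cols g v w x by (intro conjI approx_add approx_sgn indic_range chi12_range chi6_range) auto
  qed
qed

definition table_row :: "nat \<Rightarrow> bool" where
  "table_row m \<longleftrightarrow> (\<exists>l l' s. row_check (int m) l l' s \<and> approx l (ln (real m)) \<and> approx l' (ln (real m + 1)) \<and> encloses s m)"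

text \<open>Invariant with a shift: \<open>s\<close> encloses the sums up to n, while
  \<open>l\<close> already belongs to the next argument n + 1.\<close>

lemma loop_sound:
  assumes "1 \<le> n" "n \<le> 1000" "loop [int n + 1..1000] l s" "approx l (ln (real n + 1))" "encloses s n"
  shows "(\<forall>m. n < m \<longrightarrow> m \<le> 1000 \<longrightarrow> table_row m) \<and> (\<exists>s. final_check s \<and> encloses s 1000)"
  using assms
proof (induction "1000 - n" arbitrary: n l s)
  case 0
  then have "n = 1000" by simp
  with 0 show ?case by auto
next
  case (Suc k)
  then have n: "n < 1000" by simp
  have up: "[int n + 1..1000] = (int n + 1) # [int (Suc n) + 1..1000]"
    using n by (subst upto_rec1) auto
  define s' where "s' = update (int n + 1) l s"
  define l' where "l' = ivl_add l (ln_incr (2 * (int n + 1) + 1))"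
  have c: "row_check (int n + 1) l l' s'" "loop [int (Suc n) + 1..1000] l' s'"
    using Suc.prems(3) unfolding up by (auto simp: s'_def l'_def split: if_splits)
  have s': "encloses s' (Suc n)"
    using encloses_update[of s n l] Suc.prems n by (simp add: s'_def add.commute)
  have l': "approx l' (ln (real (Suc n) + 1))"
    using approx_add[OF Suc.prems(4) approx_ln_incr[of "Suc n"]] by (simp add: l'_def add_ac)
  have IH: "(\<forall>m. Suc n < m \<longrightarrow> m \<le> 1000 \<longrightarrow> table_row m) \<and> (\<exists>s. final_check s \<and> encloses s 1000)"
    using Suc.hyps(2) n c(2) l' s' by (intro Suc.hyps(1)) auto
  moreover have "table_row (Suc n)"
    unfolding table_row_def using c(1) Suc.prems(4) l' s' by (intro exI[of _ l] exI[of _ l'] exI[of _ s']) (auto simp: add_ac)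
  ultimately show ?case by (metis Suc_lessI)
qed

section \<open>Conclusion\<close>

lemma table_correct:
  shows "2 \<le> m \<Longrightarrow> m \<le> 1000 \<Longrightarrow> table_row m" and "\<exists>s. final_check s \<and> encloses s 1000"
proof -
  have ln2: "approx (6931400, 6931500) (ln (real 1 + 1))"
    using ln_2_bounds by (simp add: approx_def)
  have run: "loop [int 1 + 1..1000] (6931400, 6931500) initial_columns"
    using loop_1000 by (simp only: of_nat_1 one_add_one)
  have *: "(\<forall>m. 1 < m \<longrightarrow> m \<le> 1000 \<longrightarrow> table_row m) \<and> (\<exists>s. final_check s \<and> encloses s 1000)"
    by (rule loop_sound[OF _ _ run ln2 encloses_initial]) simp_all
  from * show "\<exists>s. final_check s \<and> encloses s 1000" ..
  assume "2 \<le> m" "m \<le> 1000"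
  with * show "table_row m" by simp
qed

lemma table_rowD:
  assumes "table_row m"
  defines "l \<equiv> ln (real m)" and "l' \<equiv> ln (real m + 1)"
  shows "l' / 2 - 12/10 \<le> H_nat 4 1 m \<and> H_nat 4 1 m \<le> l / 2"
    "7 \<le> m \<Longrightarrow> l' / 2 - 6066/10000 \<le> H_nat 4 3 m" "H_nat 4 3 m \<le> l / 2"
    "l' / 2 - 139/100 \<le> H_nat 3 1 m \<and> H_nat 3 1 m \<le> l / 2"
    "4 \<le> m \<Longrightarrow> l' / 2 - 3465/10000 \<le> H_nat 3 2 m" "H_nat 3 2 m \<le> l / 2 + 27/100"
    "166 \<le> m \<Longrightarrow> \<bar>msum (\<lambda>_. 1) m - l + 5737/10000\<bar> \<le> 1545/10000"
    "90 \<le> m \<Longrightarrow> \<bar>chi_msum chi12 m - 29/1000\<bar> \<le> 205/1000"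
    "200 \<le> m \<Longrightarrow> \<bar>chi_msum chi6 m + 1373/10000\<bar> \<le> 232/1000"
    "psi m \<le> 115/100 * real m"
proof -
  obtain L L' s where *: "row_check (int m) L L' s" "approx L l" "approx L' l'" "encloses s m"
    using assms by (auto simp: table_row_def)
  obtain a1 a2 a3 a4 a5 a6 a7 a8 a9 a10 a11 a12 where s: "s = Columns a1 a2 a3 a4 a5 a6 a7 a8 a9 a10 a11 a12"
    by (cases s)
  obtain x y x' y' where L: "L = (x, y)" "L' = (x', y')" by (metis surj_pair)
  note c = *(1)[unfolded s L row_check.simps of_int_le_iff[where ?'a = real, symmetric] of_int_diff of_int_add of_int_mult
      of_int_minus of_int_numeral of_int_of_nat_eq]
  note e = *(2,3)[unfolded L approx_def fst_conv snd_conv] *(4)[unfolded s encloses.simps approx_def]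
  show "l' / 2 - 12/10 \<le> H_nat 4 1 m \<and> H_nat 4 1 m \<le> l / 2" using c e by argo
  show "7 \<le> m \<Longrightarrow> l' / 2 - 6066/10000 \<le> H_nat 4 3 m" using c e by simp
  show "H_nat 4 3 m \<le> l / 2" using c e by argo
  show "l' / 2 - 139/100 \<le> H_nat 3 1 m \<and> H_nat 3 1 m \<le> l / 2" using c e by argo
  show "4 \<le> m \<Longrightarrow> l' / 2 - 3465/10000 \<le> H_nat 3 2 m" using c e by simp
  show "H_nat 3 2 m \<le> l / 2 + 27/100" using c e by argo
  show "\<bar>msum (\<lambda>_. 1) m - l + 5737/10000\<bar> \<le> 1545/10000" if "166 \<le> m"
  proof -
    \<comment> \<open>The guards of \<open>row_check\<close> were turned into real inequalities
      together with the bounds, so the hypothesis is supplied in that form.\<close>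
    have "real 166 \<le> real m" using that by (simp only: of_nat_le_iff)
    then show ?thesis using c e unfolding abs_le_iff of_nat_numeral by argo
  qed
  show "\<bar>chi_msum chi12 m - 29/1000\<bar> \<le> 205/1000" if "90 \<le> m"
  proof -
    have "real 90 \<le> real m" using that by (simp only: of_nat_le_iff)
    then show ?thesis using c e unfolding abs_le_iff of_nat_numeral by argo
  qed
  show "\<bar>chi_msum chi6 m + 1373/10000\<bar> \<le> 232/1000" if "200 \<le> m"
  proof -
    have "real 200 \<le> real m" using that by (simp only: of_nat_le_iff)
    then show ?thesis using c e unfolding abs_le_iff of_nat_numeral by argo
  qed
  show "psi m \<le> 115/100 * real m" using c e by argo
qed

lemma table_final:
  "\<bar>chi_ln_sum chi12 1000 - 304/10000\<bar> \<le> 1/1000" "\<bar>chi_ln_sum chi6 1000 + 1222/10000\<bar> \<le> 1/1000"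
  "neg_sum chi12 1000 \<le> 93/1000" "neg_sum chi6 1000 \<le> 124/1000"
proof -
  obtain s where *: "final_check s" "encloses s 1000" using table_correct(2) by blast
  obtain a1 a2 a3 a4 a5 a6 a7 a8 a9 a10 a11 a12 where s: "s = Columns a1 a2 a3 a4 a5 a6 a7 a8 a9 a10 a11 a12"
    by (cases s)
  note c = *(1)[unfolded s final_check.simps of_int_le_iff[where ?'a = real, symmetric] of_int_minus of_int_numeral]
  note e = *(2)[unfolded s encloses.simps approx_def]
  show "\<bar>chi_ln_sum chi12 1000 - 304/10000\<bar> \<le> 1/1000" "\<bar>chi_ln_sum chi6 1000 + 1222/10000\<bar> \<le> 1/1000"
    unfolding abs_le_iff using c e by argo+
  show "neg_sum chi12 1000 \<le> 93/1000" "neg_sum chi6 1000 \<le> 124/1000" using c e by argo+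
qed

lemma psi_bound: "psi n \<le> 115/100 * real n"
proof (rule psi_le)
  fix n :: nat assume n: "n < 1000"
  show "psi n \<le> 115/100 * real n"
  proof (cases "n \<ge> 2")
    case True
    then show ?thesis using table_rowD(10) table_correct(1) n by simp
  next
    case False
    then have "n = 0 \<or> n = 1" by auto
    then show ?thesis by (auto simp: psi_def)
  qed
qed

lemma msum_bounds:
  assumes n: "n \<ge> 1000"
  shows "\<bar>msum (\<lambda>_. 1) n - ln (real n) + 5737/10000\<bar> \<le> 1545/10000"
    "\<bar>chi_msum chi12 n - 29/1000\<bar> \<le> 205/1000"
    "\<bar>chi_msum chi6 n + 1373/10000\<bar> \<le> 232/1000"
proof -
  have row: "table_row m" if "90 \<le> m" "m < 1000" for m using table_correct(1) that by simp
  show "\<bar>msum (\<lambda>_. 1) n - ln (real n) + 5737/10000\<bar> \<le> 1545/10000"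
  proof (rule msum_one_bound[OF psi_bound])
    show "\<bar>msum (\<lambda>_. 1) m - ln (real m) + 5737/10000\<bar> \<le> 1545/10000" if "166 \<le> m" "m < 1000" for m
      using that by (intro table_rowD(7) row) simp_all
  qed (use n in simp)
  show "\<bar>chi_msum chi12 n - 29/1000\<bar> \<le> 205/1000"
  proof (rule msum_chi12_bound[OF psi_bound _ table_final(1)])
    show "\<bar>chi_msum chi12 m - 29/1000\<bar> \<le> 205/1000" if "90 \<le> m" "m < 1000" for m
      using that by (intro table_rowD(8) row) simp_all
  qed (use n in simp)
  show "\<bar>chi_msum chi6 n + 1373/10000\<bar> \<le> 232/1000"
  proof (rule msum_chi6_bound[OF psi_bound _ table_final(2)])
    show "\<bar>chi_msum chi6 m + 1373/10000\<bar> \<le> 232/1000" if "200 \<le> m" "m < 1000" for m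
      using that by (intro table_rowD(9) row) simp_all
  qed (use n in simp)
qed

lemma H_nat_bounds:
  assumes n: "n \<ge> 1"
  shows "ln (real n + 1) / 2 - 12/10 \<le> H_nat 4 1 n \<and> H_nat 4 1 n \<le> ln (real n) / 2"
    "7 \<le> n \<Longrightarrow> ln (real n + 1) / 2 - 6066/10000 \<le> H_nat 4 3 n" "H_nat 4 3 n \<le> ln (real n) / 2"
    "ln (real n + 1) / 2 - 139/100 \<le> H_nat 3 1 n \<and> H_nat 3 1 n \<le> ln (real n) / 2"
    "4 \<le> n \<Longrightarrow> ln (real n + 1) / 2 - 3465/10000 \<le> H_nat 3 2 n" "H_nat 3 2 n \<le> ln (real n) / 2 + 27/100"
proof -
  define P where "P \<longleftrightarrow> (ln (real n + 1) / 2 - 12/10 \<le> H_nat 4 1 n \<and> H_nat 4 1 n \<le> ln (real n) / 2) \<and>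
    (7 \<le> n \<longrightarrow> ln (real n + 1) / 2 - 6066/10000 \<le> H_nat 4 3 n) \<and> H_nat 4 3 n \<le> ln (real n) / 2 \<and>
    (ln (real n + 1) / 2 - 139/100 \<le> H_nat 3 1 n \<and> H_nat 3 1 n \<le> ln (real n) / 2) \<and>
    (4 \<le> n \<longrightarrow> ln (real n + 1) / 2 - 3465/10000 \<le> H_nat 3 2 n) \<and> H_nat 3 2 n \<le> ln (real n) / 2 + 27/100"
  consider "n = 1" | "2 \<le> n" "n \<le> 1000" | "1000 \<le> n" using n by linarith
  then have P
  proof cases
    case 1
    then have "H_nat d a n = 0" for d a by (simp add: H_nat_def Lambda_g_eq)
    then show ?thesis unfolding P_def using 1 ln_2_bounds by simp
  next
    case 2
    then show ?thesis unfolding P_def using table_rowD[OF table_correct(1)[of n]] by blast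
  next
    case 3
    define l where "l = ln (real n)"
    define l' where "l' = ln (real n + 1)"
    have "l' - l = ln (1 + 1 / real n)"
      using 3 ln_div[of "real n + 1" "real n"] by (simp add: l_def l'_def add_divide_distrib)
    also have "\<dots> \<le> 1 / real n" by (intro ln_add_one_self_le_self) auto
    also have "\<dots> \<le> 1/1000" using 3 by (simp add: field_simps)
    finally have l': "l' \<le> l + 1/1000" by simp
    have "p_part 2 n \<le> ln 2" "p_part 3 n \<le> ln 3 / 2"
      using p_part_bounds(1)[of 2 n] p_part_bounds(1)[of 3 n] by simp_all
    then have up: "p_part 2 n \<le> 6932/10000" "p_part 3 n \<le> 5494/10000" using ln_2_bounds ln_3_bounds by argo+
    \<comment> \<open>2^9 = 512 and 3^6 = 729 are the largest powers of 2 and 3 below 1000.\<close>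
    have "ln 2 * (511/512) \<le> p_part 2 n" "ln 3 / 2 * (728/729) \<le> p_part 3 n"
      using p_part_bounds(2)[of 2 9 n] p_part_bounds(2)[of 3 6 n] 3 by simp_all
    then have lo: "691/1000 \<le> p_part 2 n" "548/1000 \<le> p_part 3 n" using ln_2_bounds ln_3_bounds by argo+
    have E: "even_part chi12 n \<le> 93/1000 + 8/1000" "even_part chi6 n \<le> 124/1000 + 8/1000"
      using 3 table_final(3,4)
      by (intro even_part_le_1000[OF chi12_mult chi_values(1)] even_part_le_1000[OF chi6_mult chi_values(4)]; simp add: neg_sum_def)+
    note E0 = even_part_nonneg[of chi12 n] even_part_nonneg[of chi6 n]
    \<comment> \<open>After doubling, the lower bound for 2 mod 3 is the narrowest: -0.7282 - 0.0947
      + 0.691 - 0.5494 exceeds -0.693 by less than 0.012, of which 0.001 pays for ln (n + 1) in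
      place of ln n. The other inequalities have at least 0.05 to spare.\<close>
    from msum_bounds[OF 3] two_H_nat[of n] up lo E E0 l' show ?thesis
      unfolding P_def l_def[symmetric] l'_def[symmetric] abs_le_iff by argo
  qed
  then show "ln (real n + 1) / 2 - 12/10 \<le> H_nat 4 1 n \<and> H_nat 4 1 n \<le> ln (real n) / 2"
    "7 \<le> n \<Longrightarrow> ln (real n + 1) / 2 - 6066/10000 \<le> H_nat 4 3 n" "H_nat 4 3 n \<le> ln (real n) / 2"
    "ln (real n + 1) / 2 - 139/100 \<le> H_nat 3 1 n \<and> H_nat 3 1 n \<le> ln (real n) / 2"
    "4 \<le> n \<Longrightarrow> ln (real n + 1) / 2 - 3465/10000 \<le> H_nat 3 2 n" "H_nat 3 2 n \<le> ln (real n) / 2 + 27/100"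
    unfolding P_def by blast+
qed

section \<open>Suprema and infima over real x\<close>

lemma H_eq_H_nat: "H x d a = H_nat d a (nat \<lfloor>x\<rfloor>)"
  by (simp add: H_def H_nat_def)

text \<open>On [n, n+1) the sum is constant and the logarithm increases, so the values lie between
  the left limit at n + 1 and the value at n.\<close>

lemma H_cases:
  assumes "x \<ge> 1"
  obtains n where "n \<ge> 1" "real n \<le> x" "x < real n + 1" "H x d a = H_nat d a n"
    "H_nat d a n - ln (real n + 1) / 2 \<le> H x d a - ln x / 2" "H x d a - ln x / 2 \<le> H_nat d a n - ln (real n) / 2"
proof (rule that[of "nat \<lfloor>x\<rfloor>"])
  have f: "\<lfloor>x\<rfloor> \<ge> 1" using assms by (simp add: le_floor_iff)
  show n: "nat \<lfloor>x\<rfloor> \<ge> 1" using f by linarith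
  show b: "real (nat \<lfloor>x\<rfloor>) \<le> x" "x < real (nat \<lfloor>x\<rfloor>) + 1" using f by (simp; linarith)+
  show "H x d a = H_nat d a (nat \<lfloor>x\<rfloor>)" by (rule H_eq_H_nat)
  have "ln x \<le> ln (real (nat \<lfloor>x\<rfloor>) + 1)" using b assms by (intro ln_mono) auto
  then show "H_nat d a (nat \<lfloor>x\<rfloor>) - ln (real (nat \<lfloor>x\<rfloor>) + 1) / 2 \<le> H x d a - ln x / 2"
    by (simp add: H_eq_H_nat)
  have "ln (real (nat \<lfloor>x\<rfloor>)) \<le> ln x" using b n by (intro ln_mono) auto
  then show "H x d a - ln x / 2 \<le> H_nat d a (nat \<lfloor>x\<rfloor>) - ln (real (nat \<lfloor>x\<rfloor>)) / 2"
    by (simp add: H_eq_H_nat)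
qed

text \<open>The supremum 0 is attained at x = 1, where both the sum and the logarithm
  vanish.\<close>

lemma C_plus_eq_0:
  assumes "\<And>n. n \<ge> 1 \<Longrightarrow> H_nat d a n \<le> ln (real n) / 2"
  shows "C_plus d a = 0"
  unfolding C_plus_def
proof (rule cSup_eq_maximum)
  have "H 1 d a = 0" by (simp add: H_eq_H_nat H_nat_def Lambda_g_eq)
  then show "0 \<in> (\<lambda>x. H x d a - ln x / 2) ` {1..}" by (force intro: image_eqI[of _ _ 1])
  fix y assume "y \<in> (\<lambda>x. H x d a - ln x / 2) ` {1..}"
  then obtain x where "x \<ge> 1" "y = H x d a - ln x / 2" by auto
  moreover from H_cases[OF this(1), of d a] obtain n where "n \<ge> 1" "H x d a - ln x / 2 \<le> H_nat d a n - ln (real n) / 2" by blast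
  ultimately show "y \<le> 0" using assms[of n] by simp
qed

lemma C_minus_ge:
  assumes "\<And>n. n \<ge> 1 \<Longrightarrow> c \<le> H_nat d a n - ln (real n + 1) / 2"
  shows "c \<le> C_minus d a"
  unfolding C_minus_def
proof (rule cInf_greatest)
  fix y assume "y \<in> (\<lambda>x. H x d a - ln x / 2) ` {1..}"
  then obtain x where "x \<ge> 1" "y = H x d a - ln x / 2" by auto
  moreover from H_cases[OF this(1), of d a] obtain n where "n \<ge> 1" "H_nat d a n - ln (real n + 1) / 2 \<le> H x d a - ln x / 2" by blast
  ultimately show "c \<le> y" using assms[of n] by simp
qed auto

text \<open>The infimum need not be attained: the sum may jump at N + 1. It is reached as the left
  limit there, through x in (N, N+1).\<close>

lemma C_minus_eq:
  assumes lower: "\<And>n. n \<ge> 1 \<Longrightarrow> h - ln (real N + 1) / 2 \<le> H_nat d a n - ln (real n + 1) / 2"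
    and N: "N \<ge> 1" "H_nat d a N = h"
  shows "C_minus d a = h - ln (real N + 1) / 2"
proof (rule antisym)
  show "h - ln (real N + 1) / 2 \<le> C_minus d a" using lower by (rule C_minus_ge)
  have bdd: "bdd_below ((\<lambda>x. H x d a - ln x / 2) ` {1..})"
  proof (rule bdd_belowI2)
    fix x :: real assume "x \<in> {1..}"
    then have "x \<ge> 1" by simp
    from H_cases[OF this, of d a] obtain n where "n \<ge> 1" "H_nat d a n - ln (real n + 1) / 2 \<le> H x d a - ln x / 2" by blast
    then show "h - ln (real N + 1) / 2 \<le> H x d a - ln x / 2"
      using lower[of n] by simp
  qed
  have le: "C_minus d a \<le> h - ln x / 2" if "real N < x" "x < real N + 1" for x
  proof -
    have "nat \<lfloor>x\<rfloor> = N" using that by (simp add: floor_eq_iff nat_eq_iff)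
    then have "H x d a = h" using N by (simp add: H_eq_H_nat)
    moreover have "C_minus d a \<le> H x d a - ln x / 2"
      unfolding C_minus_def using that N bdd by (intro cInf_lower) auto
    ultimately show ?thesis by simp
  qed
  have "((\<lambda>x. h - ln x / 2) \<longlongrightarrow> h - ln (real N + 1) / 2) (at_left (real N + 1))"
    by (intro tendsto_intros) auto
  moreover have "\<forall>\<^sub>F x in at_left (real N + 1). C_minus d a \<le> h - ln x / 2"
    unfolding eventually_at_left_field using le by (intro exI[of _ "real N"]) auto
  ultimately show "C_minus d a \<le> h - ln (real N + 1) / 2"
    by (rule tendsto_lowerbound) simp
qed

lemma H_nat_mono: "m \<le> n \<Longrightarrow> H_nat d a m \<le> H_nat d a n"
  unfolding H_nat_def by (intro sum_mono2) (auto simp: Lambda_g_eq mangoldt_nonneg)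

lemma H_nat_small: "H_nat d a 1 = 0" "H_nat 3 2 2 = ln 2 / 2" "H_nat 4 3 3 = ln 3 / 3" "H_nat 4 3 6 = ln 3 / 3"
proof -
  have Suc: "H_nat d a (Suc n) = H_nat d a n + Lambda_g d a (Suc n) / real (Suc n)" for d a n
    by (simp add: H_nat_def)
  have num: "H_nat d a (numeral k) = H_nat d a (pred_numeral k) + Lambda_g d a (numeral k) / numeral k" for d a k
    using Suc[of d a "pred_numeral k", folded numeral_eq_Suc] by simp
  show 1: "H_nat d a 1 = 0" for d a by (simp add: H_nat_def Lambda_g_eq)
  have ap4: "aprimedivisor (4::nat) = 2" using aprimedivisor_prime_power[of "2::nat" 2] by simp
  have mg6: "mangoldt 6 = (0::real)" using not_primepowI[of "2::nat" 3 6] by (simp add: mangoldt_def)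
  have 2: "Lambda_g 3 2 2 = ln 2" "Lambda_g 4 3 2 = 0" "Lambda_g 4 3 3 = ln 3" "Lambda_g 4 3 4 = 0"
    "Lambda_g 4 3 5 = 0" "Lambda_g 4 3 6 = 0"
    by (simp_all add: Lambda_g_eq cong_def ap4 mg6)
  show "H_nat 3 2 2 = ln 2 / 2" using 1[of 3 2] 2 by (simp add: num)
  show "H_nat 4 3 3 = ln 3 / 3" "H_nat 4 3 6 = ln 3 / 3" using 1[of 4 3] 2 by (simp_all add: num)
qed

lemma ln_7_ge: "19458/10000 \<le> ln (7::real)"
proof -
  have "ln (8/7::real) \<le> 13354/100000"
    using ln_approx_bounds[of "8/7" 2] by (simp add: eval_nat_numeral)
  moreover have "ln (8/7::real) = 3 * ln 2 - ln 7"
    using ln_realpow[of 2 3] by (simp add: ln_div)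
  ultimately show ?thesis using ln_2_bounds by simp
qed

lemma C_minus_4_3: "C_minus 4 3 = ln 3 / 3 - ln 7 / 2"
proof -
  have r7: "real 6 + 1 = 7" by simp
  have "C_minus 4 3 = ln 3 / 3 - ln (real 6 + 1) / 2"
  proof (rule C_minus_eq)
    fix n :: nat assume n: "n \<ge> 1"
    consider "n \<le> 2" | "3 \<le> n" "n \<le> 6" | "7 \<le> n" by linarith
    then show "ln 3 / 3 - ln (real 6 + 1) / 2 \<le> H_nat 4 3 n - ln (real n + 1) / 2"
    proof cases
      case 1
      have "H_nat 4 3 n \<ge> 0" using H_nat_mono[OF n, of 4 3] H_nat_small(1) by simp
      moreover have "ln (real n + 1) \<le> ln 3" using 1 by (intro ln_mono) auto
      ultimately show ?thesis using ln_7_ge ln_3_bounds unfolding r7 by argo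
    next
      case 2
      have "H_nat 4 3 n \<ge> ln 3 / 3" using H_nat_mono[OF 2(1), of 4 3] H_nat_small(3) by simp
      moreover have "ln (real n + 1) \<le> ln 7" using 2 by (intro ln_mono) auto
      ultimately show ?thesis unfolding r7 by argo
    next
      case 3
      \<comment> \<open>The infimum is -0.60675..., and the constant -0.6066 used from 7 on lies
        above it by only about 0.00015.\<close>
      then show ?thesis using H_nat_bounds(2)[OF n] ln_7_ge ln_3_bounds unfolding r7 by argo
    qed
  qed (simp_all add: H_nat_small)
  then show ?thesis unfolding r7 .
qed

lemma C_minus_3_2: "C_minus 3 2 = - ln 2 / 2"
proof -
  have r2: "real 1 + 1 = 2" by simp
  have "C_minus 3 2 = 0 - ln (real 1 + 1) / 2"
  proof (rule C_minus_eq)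
    fix n :: nat assume n: "n \<ge> 1"
    consider "n = 1" | "2 \<le> n" "n \<le> 3" | "4 \<le> n" using n by linarith
    then show "0 - ln (real 1 + 1) / 2 \<le> H_nat 3 2 n - ln (real n + 1) / 2"
    proof cases
      case 1
      then show ?thesis using H_nat_small(1)[of 3 2] by simp
    next
      case 2
      have "H_nat 3 2 n \<ge> ln 2 / 2" using H_nat_mono[OF 2(1), of 3 2] H_nat_small(2) by simp
      moreover have "ln (real n + 1) \<le> ln 4" using 2 by (intro ln_mono) auto
      \<comment> \<open>The same value -ln 2 / 2 is approached again as x tends to 4 from the left,
        with equality, so this range is treated exactly and not numerically.\<close>
      moreover have "ln (4::real) = 2 * ln 2" using ln_realpow[of 2 2] by simp
      ultimately show ?thesis unfolding r2 by argo
    next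
      case 3
      then show ?thesis using H_nat_bounds(5)[OF n] ln_2_bounds unfolding r2 by argo
    qed
  qed (use H_nat_small(1)[of 3 2] in simp_all)
  then show ?thesis by simp
qed

lemma C_plus_3_2: "C_plus 3 2 \<le> 27/100"
  unfolding C_plus_def
proof (rule cSup_least)
  fix y assume "y \<in> (\<lambda>x. H x 3 2 - ln x / 2) ` {1..}"
  then obtain x where x: "x \<ge> 1" "y = H x 3 2 - ln x / 2" by auto
  moreover from H_cases[OF this(1), of 3 2] obtain n where "n \<ge> 1" "H x 3 2 - ln x / 2 \<le> H_nat 3 2 n - ln (real n) / 2" by blast
  ultimately show "y \<le> 27/100" using H_nat_bounds(6)[of n] by simp
qed auto

theorem theorem5:
  shows "(C_minus 4 1 > -1.202 \<and> C_plus 4 1 = 0) \<and>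
         (C_minus 4 3 = ln 3 / 3 - ln 7 / 2 \<and> C_plus 4 3 = 0) \<and>
         (C_minus 3 1 > -1.4 \<and> C_plus 3 1 = 0) \<and>
         (C_minus 3 2 = - ln 2 / 2 \<and> C_plus 3 2 < 0.2764)"
proof -
  have "- 12/10 \<le> C_minus 4 1" using H_nat_bounds(1) by (intro C_minus_ge) force
  moreover have "- 139/100 \<le> C_minus 3 1" using H_nat_bounds(4) by (intro C_minus_ge) force
  moreover have "C_plus 4 1 = 0" "C_plus 4 3 = 0" "C_plus 3 1 = 0"
    using H_nat_bounds(1,3,4) by (auto intro!: C_plus_eq_0)
  ultimately show ?thesis using C_minus_4_3 C_minus_3_2 C_plus_3_2 by simp
qed

end
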